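(* Let $(\mathrm{Cos}(t))_{t\in\mathbb{R}}$ be a bounded cosine function on a Banach space $X$, and for $\mu\in\mathbf{M}_e(\mathbb{R})$ let $T_\mu\in\mathcal{L}(X)$ be defined by $$T_\mu x=\int_{\mathbb{R}}\mathrm{Cos}(s)x\,\mu(ds)\qquad(x\in X).$$ Let $M:=\sup_{s\in\mathbb{R}}\|\mathrm{Cos}(s)\|$ and $p\in[1,\infty)$. Then $$\|T_\mu\|\le 5M^2\,\|L_\mu\|_{\mathcal{L}(L^p(\mathbb{R};X))}\qquad\text{for all }\mu\in\mathbf{M}_e(\mathbb{R}).$$
   Context: A cosine function on a complex Banach space $X$ is a strongly continuous map $\mathrm{Cos}:\mathbb{R}\to\mathcal{L}(X)$ with $\mathrm{Cos}(0)=I$ and $\mathrm{Cos}(t+s)+\mathrm{Cos}(t-s)=2\,\mathrm{Cos}(t)\mathrm{Cos}(s)$ for all $t,s\in\mathbb{R}$; it is bounded if $\sup_{t}\|\mathrm{Cos}(t)\|<\infty$. $\mathbf{M}(\mathbb{R})$ is the space of complex regular Borel measures on $\mathbb{R}$, and $\mathbf{M}_e(\mathbb{R})$ is the subspace of even measures, i.e. those with $\mu(E)=\mu(-E)$ for all Borel sets $E$. For $\mu\in\mathbf{M}(\mathbb{R})$, $L_\mu$ denotes the convolution operator $f\mapsto\mu*f$ on $L^p(\mathbb{R};X)$. *)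

theory Defs
  imports "HOL-Analysis.Analysis"
begin

section \<open>Complex Banach spaces\<close>

class complex_banach = banach +
  fixes scaleC :: "complex \<Rightarrow> 'a \<Rightarrow> 'a" (infixr \<open>*\<^sub>C\<close> 75)
  assumes scaleC_add_right: "z *\<^sub>C (x + y) = z *\<^sub>C x + z *\<^sub>C y"
    and scaleC_add_left: "(z + w) *\<^sub>C x = z *\<^sub>C x + w *\<^sub>C x"
    and scaleC_scaleC: "z *\<^sub>C w *\<^sub>C x = (z * w) *\<^sub>C x"
    and scaleC_of_real: "complex_of_real r *\<^sub>C x = r *\<^sub>R x"
    and norm_scaleC: "norm (z *\<^sub>C x) = cmod z * norm x"

instantiation complex :: complex_banach
begin
definition scaleC_complex :: "complex \<Rightarrow> complex \<Rightarrow> complex"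
  where "scaleC_complex z w = z * w"
instance
  by standard (simp_all add: scaleC_complex_def algebra_simps norm_mult scaleR_conv_of_real)
end


section \<open>Cosine functions\<close>

text \<open>The type \<open>'a \<Rightarrow>\<^sub>L 'a\<close> consists of the bounded real-linear operators, so
  complex homogeneity has to be required separately.  The operator norm is the same.\<close>

definition cosine_function :: "(real \<Rightarrow> 'a::complex_banach \<Rightarrow>\<^sub>L 'a) \<Rightarrow> bool" where
  "cosine_function Cos \<longleftrightarrow>
     (\<forall>t z x. blinfun_apply (Cos t) (z *\<^sub>C x) = z *\<^sub>C blinfun_apply (Cos t) x) \<and>
     (\<forall>x. continuous_on UNIV (\<lambda>t. blinfun_apply (Cos t) x)) \<and>
     Cos 0 = id_blinfun \<and>
     (\<forall>t s. Cos (t + s) + Cos (t - s) = 2 *\<^sub>R (Cos t o\<^sub>L Cos s))"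


section \<open>Complex Borel measures on the real line\<close>

text \<open>A complex Borel measure is a set function; its values on non-Borel sets are irrelevant.\<close>

definition complex_borel_measure :: "(real set \<Rightarrow> complex) \<Rightarrow> bool" where
  "complex_borel_measure \<mu> \<longleftrightarrow>
     (\<forall>A :: nat \<Rightarrow> real set. range A \<subseteq> sets borel \<longrightarrow> disjoint_family A \<longrightarrow>
        (\<lambda>n. \<mu> (A n)) sums \<mu> (\<Union>n. A n))"

definition variation :: "(real set \<Rightarrow> complex) \<Rightarrow> real set \<Rightarrow> ennreal" where
  "variation \<mu> E =
     (SUP A \<in> {A :: nat \<Rightarrow> real set.
         range A \<subseteq> sets borel \<and> disjoint_family A \<and> (\<Union>n. A n) = E}.
       (\<Sum>n. ennreal (cmod (\<mu> (A n)))))"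

definition variation_measure :: "(real set \<Rightarrow> complex) \<Rightarrow> real measure" where
  "variation_measure \<mu> = measure_of UNIV (sets borel) (variation \<mu>)"

definition regular_measures :: "(real set \<Rightarrow> complex) set" where
  "regular_measures = {\<mu>. complex_borel_measure \<mu> \<and>
     (\<forall>E\<in>sets borel.
        variation \<mu> E = (INF U\<in>{U. E \<subseteq> U \<and> open U}. variation \<mu> U) \<and>
        variation \<mu> E = (SUP K\<in>{K. K \<subseteq> E \<and> compact K}. variation \<mu> K))}"

definition even_measures :: "(real set \<Rightarrow> complex) set" where
  "even_measures = {\<mu> \<in> regular_measures. \<forall>E\<in>sets borel. \<mu> (uminus ` E) = \<mu> E}"


section \<open>Bochner integration in a possibly non-separable Banach space\<close>

text \<open>The Bochner integral of the library is restricted to second countable value spaces and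
  to positive measures.  The following definitions have the same shape, with strong
  measurability in place of Borel measurability.\<close>

definition strongly_measurable :: "'b measure \<Rightarrow> ('b \<Rightarrow> 'a::real_normed_vector) \<Rightarrow> bool" where
  "strongly_measurable M f \<longleftrightarrow>
     (\<exists>s. (\<forall>n. simple_function M (s n)) \<and> (AE x in M. (\<lambda>n. s n x) \<longlonglongrightarrow> f x))"

definition simple_integral_wrt ::
    "(real set \<Rightarrow> complex) \<Rightarrow> (real \<Rightarrow> 'a::complex_banach) \<Rightarrow> 'a" where
  "simple_integral_wrt \<mu> s = (\<Sum>v\<in>range s. \<mu> (s -` {v}) *\<^sub>C v)"

definition has_integral_wrt ::
    "(real set \<Rightarrow> complex) \<Rightarrow> (real \<Rightarrow> 'a::complex_banach) \<Rightarrow> 'a \<Rightarrow> bool" where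
  "has_integral_wrt \<mu> f y \<longleftrightarrow>
     strongly_measurable (variation_measure \<mu>) f \<and>
     (\<exists>s. (\<forall>n. simple_function (variation_measure \<mu>) (s n)) \<and>
          (\<lambda>n. \<integral>\<^sup>+ x. ennreal (norm (f x - s n x)) \<partial>variation_measure \<mu>) \<longlonglongrightarrow> 0 \<and>
          (\<lambda>n. simple_integral_wrt \<mu> (s n)) \<longlonglongrightarrow> y)"

definition integral_wrt ::
    "(real set \<Rightarrow> complex) \<Rightarrow> (real \<Rightarrow> 'a::complex_banach) \<Rightarrow> 'a" where
  "integral_wrt \<mu> f =
     (if \<exists>y. has_integral_wrt \<mu> f y then THE y. has_integral_wrt \<mu> f y else 0)"


section \<open>The spaces \<open>L\<^sup>p(\<real>; X)\<close> and convolution operators\<close>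

text \<open>Elements of \<open>L\<^sup>p\<close> are represented by functions, not by classes modulo null sets.\<close>

definition Lp_norm :: "real \<Rightarrow> (real \<Rightarrow> 'a::real_normed_vector) \<Rightarrow> ennreal" where
  "Lp_norm p f = (let I = (\<integral>\<^sup>+ t. ennreal (norm (f t) powr p) \<partial>lborel)
     in if I = \<infinity> then \<infinity> else ennreal (enn2real I powr (1 / p)))"

definition Lp_space :: "real \<Rightarrow> (real \<Rightarrow> 'a::real_normed_vector) set" where
  "Lp_space p = {f. strongly_measurable lborel f \<and> Lp_norm p f < \<infinity>}"

text \<open>For \<open>f\<close> in \<open>L\<^sup>p\<close> the integral exists for almost every \<open>t\<close>.\<close>

definition convolution ::
    "(real set \<Rightarrow> complex) \<Rightarrow> (real \<Rightarrow> 'a::complex_banach) \<Rightarrow> real \<Rightarrow> 'a" where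
  "convolution \<mu> f t = integral_wrt \<mu> (\<lambda>s. f (t - s))"

text \<open>The operator norm of an operator \<open>L\<close> on \<open>L\<^sup>p(\<real>; X)\<close>, as an extended real.\<close>

definition Lp_onorm :: "real \<Rightarrow> ((real \<Rightarrow> 'a::real_normed_vector) \<Rightarrow> (real \<Rightarrow> 'a)) \<Rightarrow> ennreal" where
  "Lp_onorm p L = (SUP f \<in> {f \<in> Lp_space p. Lp_norm p f \<le> 1}. Lp_norm p (L f))"


section \<open>The operators \<open>T\<^sub>\<mu>\<close>\<close>

definition cos_transform ::
    "(real \<Rightarrow> 'a::complex_banach \<Rightarrow>\<^sub>L 'a) \<Rightarrow> (real set \<Rightarrow> complex) \<Rightarrow> 'a \<Rightarrow> 'a" where
  "cos_transform Cos \<mu> x = integral_wrt \<mu> (\<lambda>s. blinfun_apply (Cos s) x)"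

end

theory Submission
  imports Defs
begin

text \<open>
  The proof transfers the estimate from \<open>X\<close> to \<open>L\<^sup>p(\<real>; X)\<close>. For an even measure \<open>\<mu>\<close> the
  functional equation turns into \<open>Cos t (T\<^sub>\<mu> x) = \<integral> Cos (t - s) x \<mu>(ds)\<close>, because the two terms
  \<open>Cos (t + s) x\<close> and \<open>Cos (t - s) x\<close> have the same integral (\<open>cosine_cos_transform\<close>). Hence the orbit
  of \<open>y = T\<^sub>\<mu> x\<close> is the convolution of \<open>\<mu>\<close> with the orbit of \<open>x\<close>. The latter need not be in \<open>L\<^sup>p\<close>, but
  truncating it to \<open>[-R, R]\<close> with \<open>R = 2N + a\<close> changes the convolution on \<open>[-2N, 2N]\<close> by at most
  \<open>M \<parallel>x\<parallel> |\<mu>|{s. |s| > a}\<close>, which is small for large \<open>a\<close>; and the truncated orbit has norm at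
  most \<open>(2R)\<^bsup>1/p\<^esup> M \<parallel>x\<parallel>\<close>.

  To come back from the orbit of \<open>y\<close> to \<open>y\<close> itself one uses \<open>y = 2 Cos(t)\<^sup>2 y - Cos(2t) y\<close>, so that
  \<open>\<parallel>y\<parallel> \<le> 2M \<parallel>Cos t y\<parallel> + \<parallel>Cos (2t) y\<parallel>\<close> for every \<open>t\<close>. Averaging over \<open>t \<in> [-N, N]\<close> with the
  convexity of the \<open>p\<close>-th power bounds \<open>\<parallel>y\<parallel>\<close> by the \<open>L\<^sup>p\<close> norm of the convolution
  (\<open>two_scale_average\<close>). As \<open>N\<close> grows, \<open>R / (2N)\<close> tends to 1 and the lengths of the intervals cancel;
  what remains is the constant \<open>(4M + 1) M\<close> (\<open>norm_cos_transform_le\<close>). On a nonzero space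
  \<open>M \<ge> \<parallel>Cos 0\<parallel> = 1\<close>, so \<open>(4M + 1) M \<le> 5M\<^sup>2\<close>.

  For these manipulations the integrals have to exist and to be linear. The variation of a
  complex measure is a finite measure, so dominated convergence applies to uniformly bounded
  sequences of simple functions that converge pointwise, and every function that is the limit
  of such a sequence has an integral that is the limit of the elementary ones
  (\<open>integral_wrt_LIMSEQ\<close>). All integrands that occur are of this kind: they are bounded continuous
  functions, possibly multiplied by an indicator function.
\<close>

section \<open>Scalar multiplication by complex numbers\<close>

lemma scaleC_zero_left [simp]: "0 *\<^sub>C (x :: 'a::complex_banach) = 0"
  using scaleC_add_left[of 0 0 x] by simp

lemma scaleC_zero_right [simp]: "c *\<^sub>C (0 :: 'a::complex_banach) = 0"
  using scaleC_add_right[of c 0 "0 :: 'a"] by simp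

lemma scaleC_sum_left: "(\<Sum>i\<in>I. c i) *\<^sub>C (x :: 'a::complex_banach) = (\<Sum>i\<in>I. c i *\<^sub>C x)"
  by (induction I rule: infinite_finite_induct) (simp_all add: scaleC_add_left)

lemma scaleC_diff_right: "c *\<^sub>C (x - y) = c *\<^sub>C x - c *\<^sub>C (y :: 'a::complex_banach)"
  using scaleC_add_right[of c "x - y" y] by (simp add: algebra_simps)

section \<open>Bounded pointwise limits of simple functions\<close>

lemma simple_function_borel_iff:
  "simple_function borel s \<longleftrightarrow> finite (range s) \<and> (\<forall>v. s -` {v} \<in> sets borel)"
proof -
  have "s -` {v} \<in> sets borel" if "\<forall>w\<in>range s. s -` {w} \<in> sets borel" for v
  proof (cases "v \<in> range s")
    case False
    then have "s -` {v} = {}" by auto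
    then show ?thesis by simp
  qed (use that in blast)
  then show ?thesis
    unfolding simple_function_def space_borel Int_UNIV_right by blast
qed

lemma simple_function_cong_borel:
  "space M = UNIV \<Longrightarrow> sets M = sets borel \<Longrightarrow> simple_function M s \<longleftrightarrow> simple_function borel s"
  by (simp add: simple_function_def)

text \<open>Convergence is required at every point and not only almost everywhere, so that the same
  approximation serves Lebesgue measure and every variation measure, and survives reflection of
  the line. The uniform bound provides the dominating function.\<close>

definition bounded_simple_limit ::
    "(nat \<Rightarrow> real \<Rightarrow> 'a::real_normed_vector) \<Rightarrow> (real \<Rightarrow> 'a) \<Rightarrow> bool" where
  "bounded_simple_limit s f \<longleftrightarrow> (\<forall>n. simple_function borel (s n)) \<and>
     (\<exists>C. \<forall>n t. norm (s n t) \<le> C) \<and> (\<forall>t. (\<lambda>n. s n t) \<longlonglongrightarrow> f t)"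

definition approximable :: "(real \<Rightarrow> 'a::real_normed_vector) \<Rightarrow> bool" where
  "approximable f \<longleftrightarrow> (\<exists>s. bounded_simple_limit s f)"

text \<open>In a nonseparable space the difference of Borel functions need not be measurable. Here the norm
  is measurable all the same, as a pointwise limit of real simple functions.\<close>

lemma bounded_simple_limit_norm_diff_measurable:
  assumes "bounded_simple_limit s f" "simple_function borel r"
  shows "(\<lambda>t. norm (f t - r t)) \<in> borel_measurable borel"
proof (rule borel_measurable_LIMSEQ_real)
  show "(\<lambda>n. norm (s n t - r t)) \<longlonglongrightarrow> norm (f t - r t)" for t
    using assms unfolding bounded_simple_limit_def by (intro tendsto_intros) auto
  show "(\<lambda>t. norm (s n t - r t)) \<in> borel_measurable borel" for n
    using assms unfolding bounded_simple_limit_def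
    by (intro borel_measurable_simple_function simple_function_compose2[of _ _ _ "\<lambda>a b. norm (a - b)"]) auto
qed

lemma strongly_measurable_lborel_if_approximable:
  assumes "approximable f"
  shows "strongly_measurable lborel f"
  using assms unfolding approximable_def bounded_simple_limit_def strongly_measurable_def
  by (auto simp: simple_function_cong_borel[of lborel])

lemma approximable_norm_measurable:
  assumes "approximable f"
  shows "(\<lambda>t. norm (f t)) \<in> borel_measurable borel"
  using assms bounded_simple_limit_norm_diff_measurable[of _ f "\<lambda>_. 0"]
  by (auto simp: approximable_def)

lemma approximable_compose:
  assumes f: "approximable f" and \<phi>: "continuous_on UNIV \<phi>" "\<And>v. norm (\<phi> v) \<le> K * norm v"
  shows "approximable (\<lambda>t. \<phi> (f t))"
proof -
  obtain s C where s: "\<And>n. simple_function borel (s n)" "\<And>n t. norm (s n t) \<le> C"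
      "\<And>t. (\<lambda>n. s n t) \<longlonglongrightarrow> f t"
    using f unfolding approximable_def bounded_simple_limit_def by blast
  have "norm (\<phi> (s n t)) \<le> \<bar>K\<bar> * C" for n t
  proof -
    have "norm (\<phi> (s n t)) \<le> \<bar>K\<bar> * norm (s n t)"
      using \<phi>(2) by (rule order_trans) (simp add: mult_right_mono)
    also have "\<dots> \<le> \<bar>K\<bar> * C" using s(2) by (simp add: mult_left_mono)
    finally show ?thesis .
  qed
  moreover have "(\<lambda>n. \<phi> (s n t)) \<longlonglongrightarrow> \<phi> (f t)" for t
    using \<phi>(1) s(3)[of t] by (rule continuous_on_tendsto_compose) auto
  ultimately have "bounded_simple_limit (\<lambda>n t. \<phi> (s n t)) (\<lambda>t. \<phi> (f t))"
    using s(1) unfolding bounded_simple_limit_def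
    by (auto intro: simple_function_compose1[where g=\<phi>])
  then show ?thesis unfolding approximable_def by blast
qed

lemma bounded_simple_limit_add:
  assumes "bounded_simple_limit s f" "bounded_simple_limit r g"
  shows "bounded_simple_limit (\<lambda>n t. s n t + r n t) (\<lambda>t. f t + g t)"
proof -
  obtain C D where "\<And>n t. norm (s n t) \<le> C" "\<And>n t. norm (r n t) \<le> D"
    using assms unfolding bounded_simple_limit_def by blast
  then have "norm (s n t + r n t) \<le> C + D" for n t
    by (intro norm_triangle_le add_mono)
  then show ?thesis
    using assms unfolding bounded_simple_limit_def
    by (auto intro!: tendsto_intros simple_function_compose2[where h="(+)"])
qed

lemma approximable_indicator:
  assumes "approximable f" "A \<in> sets borel"
  shows "approximable (\<lambda>t. indicator A t *\<^sub>R f t)"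
proof -
  obtain s C where s: "\<And>n. simple_function borel (s n)" "\<And>n t. norm (s n t) \<le> C"
      "\<And>t. (\<lambda>n. s n t) \<longlonglongrightarrow> f t"
    using assms unfolding approximable_def bounded_simple_limit_def by blast
  have "0 \<le> C" using s(2) norm_ge_zero order_trans by blast
  have "simple_function borel (\<lambda>t. indicat_real A t *\<^sub>R s n t)" for n
    using s(1) assms(2) by (intro simple_function_compose2[where h=scaleR]) auto
  then have "bounded_simple_limit (\<lambda>n t. indicator A t *\<^sub>R s n t) (\<lambda>t. indicator A t *\<^sub>R f t)"
    using s \<open>0 \<le> C\<close> unfolding bounded_simple_limit_def
    by (auto intro!: tendsto_intros exI[of _ C] split: split_indicator)
  then show ?thesis unfolding approximable_def by blast
qed

text \<open>The approximants round the argument down to a multiple of \<open>1 / (n + 1)\<close> and vanish outside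
  \<open>[-n, n]\<close>; they take finitely many values of \<open>g\<close>, so separability of the space is not an issue.\<close>

lemma approximable_continuous:
  fixes g :: "real \<Rightarrow> 'a::real_normed_vector"
  assumes cont: "continuous_on UNIV g" and bound: "\<And>t. norm (g t) \<le> C"
  shows "approximable g"
proof -
  define q where "q n t = (if \<bar>t\<bar> \<le> real n then \<lfloor>real (Suc n) * t\<rfloor> else 0)" for n t
  define s where "s n t = indicat_real {-real n..real n} t *\<^sub>R g (real_of_int (q n t) / real (Suc n))" for n t
  have "0 \<le> C" using bound norm_ge_zero order_trans by blast
  have q: "simple_function borel (q n)" for n
    unfolding simple_function_borel_iff
  proof
    have [measurable]: "q n \<in> borel \<rightarrow>\<^sub>M count_space UNIV"
      unfolding q_def by measurable
    show "\<forall>v. q n -` {v} \<in> sets borel"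
      using measurable_sets[of "q n" borel "count_space UNIV"] by auto
    have "q n t \<in> {- int (Suc n * n)..int (Suc n * n)}" for t
    proof (cases "\<bar>t\<bar> \<le> real n")
      case True
      then have "real (Suc n) * - real n \<le> real (Suc n) * t" "real (Suc n) * t \<le> real (Suc n) * real n"
        by (intro mult_left_mono; simp)+
      then have "real_of_int (- int (Suc n * n)) \<le> real (Suc n) * t"
          "real (Suc n) * t \<le> real_of_int (int (Suc n * n))"
        by (simp_all only: of_int_minus of_int_of_nat_eq of_nat_mult of_int_mult mult_minus_right)
      then have "- int (Suc n * n) \<le> \<lfloor>real (Suc n) * t\<rfloor>" "\<lfloor>real (Suc n) * t\<rfloor> \<le> int (Suc n * n)"
        by (metis floor_mono floor_of_int)+
      then show ?thesis
        using True unfolding q_def by simp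
    qed (simp add: q_def del: of_nat_mult)
    then have "range (q n) \<subseteq> {- int (Suc n * n)..int (Suc n * n)}" by blast
    then show "finite (range (q n))" by (auto intro: finite_subset)
  qed
  have "simple_function borel (s n)" for n
    unfolding s_def using q[of n]
    by (intro simple_function_compose2[where h="\<lambda>a b. a *\<^sub>R g (real_of_int b / real (Suc n))"]) auto
  moreover have "norm (s n t) \<le> C" for n t
    using bound \<open>0 \<le> C\<close> by (auto simp: s_def split: split_indicator)
  moreover have "(\<lambda>n. s n t) \<longlonglongrightarrow> g t" for t
  proof -
    have "(\<lambda>n. real_of_int \<lfloor>real (Suc n) * t\<rfloor> / real (Suc n)) \<longlonglongrightarrow> t"
    proof (rule tendsto_sandwich)
      show "\<forall>\<^sub>F n in sequentially. t - inverse (real (Suc n)) \<le> real_of_int \<lfloor>real (Suc n) * t\<rfloor> / real (Suc n)"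
      proof (rule always_eventually, safe)
        fix n
        have "t - inverse (real (Suc n)) = (real (Suc n) * t - 1) / real (Suc n)"
          by (simp add: field_simps del: of_nat_Suc)
        also have "\<dots> \<le> real_of_int \<lfloor>real (Suc n) * t\<rfloor> / real (Suc n)"
          by (intro divide_right_mono) linarith+
        finally show "t - inverse (real (Suc n)) \<le> real_of_int \<lfloor>real (Suc n) * t\<rfloor> / real (Suc n)" .
      qed
      show "\<forall>\<^sub>F n in sequentially. real_of_int \<lfloor>real (Suc n) * t\<rfloor> / real (Suc n) \<le> t"
      proof (rule always_eventually, safe)
        fix n
        have "real_of_int \<lfloor>real (Suc n) * t\<rfloor> \<le> real (Suc n) * t" by linarith
        then show "real_of_int \<lfloor>real (Suc n) * t\<rfloor> / real (Suc n) \<le> t"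
          by (simp add: field_simps del: of_nat_Suc)
      qed
      show "(\<lambda>n. t - inverse (real (Suc n))) \<longlonglongrightarrow> t"
        using tendsto_diff[OF tendsto_const LIMSEQ_inverse_real_of_nat, of t] by simp
    qed simp
    with cont have "(\<lambda>n. g (real_of_int \<lfloor>real (Suc n) * t\<rfloor> / real (Suc n))) \<longlonglongrightarrow> g t"
      by (rule continuous_on_tendsto_compose) auto
    moreover have "\<forall>\<^sub>F n in sequentially. g (real_of_int \<lfloor>real (Suc n) * t\<rfloor> / real (Suc n)) = s n t"
    proof (rule eventually_sequentiallyI)
      fix n assume "nat \<lceil>\<bar>t\<bar>\<rceil> \<le> n"
      then have "\<bar>t\<bar> \<le> real n" by linarith
      then show "g (real_of_int \<lfloor>real (Suc n) * t\<rfloor> / real (Suc n)) = s n t"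
        unfolding s_def q_def by (auto simp: abs_le_iff)
    qed
    ultimately show ?thesis by (rule Lim_transform_eventually)
  qed
  ultimately have "bounded_simple_limit s g"
    unfolding bounded_simple_limit_def by blast
  then show ?thesis unfolding approximable_def by blast
qed

section \<open>The total variation of a complex measure is a finite measure\<close>

text \<open>Each summand is approximated from below separately. Nothing lies below 0, which is why both
  summands have to be positive.\<close>

lemma ennreal_add_le_dense:
  fixes x y c :: ennreal
  assumes le: "\<And>a b. a < x \<Longrightarrow> b < y \<Longrightarrow> a + b \<le> c" and pos: "0 < x" "0 < y"
  shows "x + y \<le> c"
proof -
  have 1: "x + b \<le> c" if b: "b < y" for b
  proof -
    have "x + b = (SUP a\<in>{..<x}. a) + b" by simp
    also have "\<dots> = (SUP a\<in>{..<x}. a + b)"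
      using pos by (intro ennreal_SUP_add_left[symmetric]) auto
    also have "\<dots> \<le> c" using le b by (intro SUP_least) auto
    finally show ?thesis .
  qed
  have "x + y = (SUP b\<in>{..<y}. b) + x" by (simp add: add.commute)
  also have "\<dots> = (SUP b\<in>{..<y}. b + x)"
    using pos by (intro ennreal_SUP_add_left[symmetric]) auto
  also have "\<dots> \<le> c" using 1 by (intro SUP_least) (auto simp: add.commute)
  finally show ?thesis .
qed

context
  fixes \<mu> :: "real set \<Rightarrow> complex"
  assumes \<mu>: "complex_borel_measure \<mu>"
begin

lemma complex_measure_sums:
  assumes "range A \<subseteq> sets borel" "disjoint_family A"
  shows "(\<lambda>n. \<mu> (A n)) sums \<mu> (\<Union>n. A n)"
  using \<mu> assms unfolding complex_borel_measure_def by blast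

lemma complex_measure_empty: "\<mu> {} = 0"
proof -
  have "summable (\<lambda>n::nat. \<mu> {})"
    using complex_measure_sums[of "\<lambda>_. {}"] by (auto simp: sums_iff disjoint_family_on_def)
  then show ?thesis by (simp add: summable_const_iff)
qed

lemma complex_measure_UN_finite:
  assumes "finite J" and A: "\<And>i. i \<in> J \<Longrightarrow> A i \<in> sets borel"
    and disj: "disjoint_family_on A J"
  shows "\<mu> (\<Union>i\<in>J. A i) = (\<Sum>i\<in>J. \<mu> (A i))"
proof -
  obtain e :: "nat \<Rightarrow> _" where e: "bij_betw e {..<card J} J"
    using bij_betw_from_nat_into_finite[OF \<open>finite J\<close>] by blast
  define B where "B n = (if n < card J then A (e n) else {})" for n
  have "range B \<subseteq> sets borel"
    using A bij_betwE[OF e] by (auto simp: B_def)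
  moreover have "disjoint_family B"
    using disj bij_betwE[OF e] bij_betw_imp_inj_on[OF e]
    by (auto simp: disjoint_family_on_def B_def inj_on_def) blast
  ultimately have "(\<lambda>n. \<mu> (B n)) sums \<mu> (\<Union>n. B n)" by (rule complex_measure_sums)
  moreover have "(\<lambda>n. \<mu> (B n)) sums (\<Sum>n<card J. \<mu> (B n))"
    by (rule sums_finite) (auto simp: B_def complex_measure_empty)
  ultimately have "\<mu> (\<Union>n. B n) = (\<Sum>n<card J. \<mu> (B n))" by (rule sums_unique2)
  also have "(\<Sum>n<card J. \<mu> (B n)) = (\<Sum>n<card J. \<mu> (A (e n)))" by (simp add: B_def)
  also have "\<dots> = (\<Sum>i\<in>J. \<mu> (A i))" by (rule sum.reindex_bij_betw[OF e])
  also have "(\<Union>n. B n) = (\<Union>n<card J. A (e n))" by (auto simp: B_def)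
  also have "\<dots> = \<Union> (A ` (e ` {..<card J}))" by (simp only: image_image)
  also have "e ` {..<card J} = J" by (rule bij_betw_imp_surj_on[OF e])
  finally show ?thesis .
qed

lemma complex_measure_Diff:
  assumes "A \<in> sets borel" "E \<in> sets borel" "A \<subseteq> E"
  shows "\<mu> (E - A) = \<mu> E - \<mu> A"
proof -
  have "\<mu> (\<Union>b\<in>UNIV. if b then A else E - A) = (\<Sum>b\<in>UNIV. \<mu> (if b then A else E - A))"
    using assms by (intro complex_measure_UN_finite) (auto simp: disjoint_family_on_def)
  moreover have "(\<Union>b\<in>UNIV. if b then A else E - A) = E"
    using assms by (auto split: if_splits)
  ultimately show ?thesis by (simp add: UNIV_bool)
qed

text \<open>A finite disjoint family becomes a countable partition of \<open>E\<close> once the uncovered rest of \<open>E\<close> and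
  empty cells are appended. Hence the supremum over countable partitions can be handled through
  finite families.\<close>

lemma sum_le_variation:
  fixes A :: "nat \<Rightarrow> real set"
  assumes A: "\<And>i. i < n \<Longrightarrow> A i \<in> sets borel" "\<And>i. i < n \<Longrightarrow> A i \<subseteq> E"
    and disj: "disjoint_family_on A {..<n}" and E: "E \<in> sets borel"
  shows "(\<Sum>i<n. ennreal (cmod (\<mu> (A i)))) \<le> variation \<mu> E"
proof -
  define B where "B i = (if i < n then A i else if i = n then E - (\<Union>i<n. A i) else {})" for i
  have "(\<Sum>i<n. ennreal (cmod (\<mu> (A i)))) = (\<Sum>i<n. ennreal (cmod (\<mu> (B i))))"
    by (simp add: B_def)
  also have "\<dots> \<le> (\<Sum>i. ennreal (cmod (\<mu> (B i))))"
    by (rule sum_le_suminf) auto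
  also have "\<dots> \<le> variation \<mu> E"
    unfolding variation_def
  proof (rule SUP_upper, safe)
    show "B i \<in> sets borel" for i using A E by (auto simp: B_def)
    show "disjoint_family B"
      using disj unfolding disjoint_family_on_def B_def by (auto split: if_splits)
    show "x \<in> E" if "x \<in> B i" for x i using that A by (auto simp: B_def split: if_splits)
    show "x \<in> (\<Union>i. B i)" if "x \<in> E" for x
    proof (cases "\<exists>i<n. x \<in> A i")
      case True then show ?thesis by (auto simp: B_def)
    next
      case False
      then have "x \<in> B n" using that by (auto simp: B_def)
      then show ?thesis by blast
    qed
  qed
  finally show ?thesis .
qed

lemma less_variationE:
  assumes "a < variation \<mu> E"
  obtains A :: "nat \<Rightarrow> real set" and n where "range A \<subseteq> sets borel" "disjoint_family A"
    "(\<Union>i. A i) = E" "a < (\<Sum>i<n. ennreal (cmod (\<mu> (A i))))"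
proof -
  obtain A :: "nat \<Rightarrow> real set" where A: "range A \<subseteq> sets borel" "disjoint_family A" "(\<Union>i. A i) = E"
    and less: "a < (\<Sum>i. ennreal (cmod (\<mu> (A i))))"
    using assms unfolding variation_def less_SUP_iff by blast
  obtain n where "a < (\<Sum>i<n. ennreal (cmod (\<mu> (A i))))"
    using less unfolding suminf_eq_SUP less_SUP_iff by blast
  with A show ?thesis by (rule that)
qed

lemma cmod_le_variation:
  assumes "E \<in> sets borel"
  shows "ennreal (cmod (\<mu> E)) \<le> variation \<mu> E"
  using sum_le_variation[of "Suc 0" "\<lambda>_. E" E] assms by (simp add: disjoint_family_on_def)

lemma variation_mono:
  assumes "E \<subseteq> F" "F \<in> sets borel"
  shows "variation \<mu> E \<le> variation \<mu> F"
proof (rule dense_le)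
  fix a assume "a < variation \<mu> E"
  then obtain A n where A: "range A \<subseteq> sets borel" "disjoint_family A" "(\<Union>i. A i) = E"
    and less: "a < (\<Sum>i<(n::nat). ennreal (cmod (\<mu> (A i))))"
    by (rule less_variationE)
  have "(\<Sum>i<n. ennreal (cmod (\<mu> (A i)))) \<le> variation \<mu> F"
    using A assms by (intro sum_le_variation) (force simp: disjoint_family_on_def)+
  with less show "a \<le> variation \<mu> F" by simp
qed

lemma variation_superadditive:
  assumes "E \<inter> F = {}" and [measurable]: "E \<in> sets borel" "F \<in> sets borel"
  shows "variation \<mu> E + variation \<mu> F \<le> variation \<mu> (E \<union> F)"
proof -
  have "a + b \<le> variation \<mu> (E \<union> F)" if ab: "a < variation \<mu> E" "b < variation \<mu> F" for a b
  proof -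
    obtain A n where A: "range A \<subseteq> sets borel" "disjoint_family A" "(\<Union>i. A i) = E"
      and a: "a < (\<Sum>i<(n::nat). ennreal (cmod (\<mu> (A i))))"
      using ab(1) by (rule less_variationE)
    obtain B m where B: "range B \<subseteq> sets borel" "disjoint_family B" "(\<Union>i. B i) = F"
      and b: "b < (\<Sum>i<(m::nat). ennreal (cmod (\<mu> (B i))))"
      using ab(2) by (rule less_variationE)
    define C where "C i = (if i < n then A i else B (i - n))" for i
    have "a + b \<le> (\<Sum>i<n. ennreal (cmod (\<mu> (A i)))) + (\<Sum>i<m. ennreal (cmod (\<mu> (B i))))"
      using a b by (intro add_mono) auto
    also have "\<dots> = (\<Sum>i<n. ennreal (cmod (\<mu> (C i)))) + (\<Sum>i<m. ennreal (cmod (\<mu> (C (n + i)))))"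
      by (simp add: C_def)
    also have "\<dots> = (\<Sum>i<n+m. ennreal (cmod (\<mu> (C i))))"
      by (induction m) (simp_all add: add.assoc)
    also have "\<dots> \<le> variation \<mu> (E \<union> F)"
    proof (rule sum_le_variation)
      have *: "A i \<inter> B j = {}" for i j using A(3) B(3) assms(1) by blast
      have "C i \<inter> C j = {}" if "i \<noteq> j" for i j
        using that A(2) B(2) *[of i "j - n"] *[of j "i - n"]
        unfolding disjoint_family_on_def C_def by (auto simp: Int_commute)
      then show "disjoint_family_on C {..<n+m}" by (auto simp: disjoint_family_on_def)
    qed (use A B in \<open>auto simp: C_def\<close>)
    finally show ?thesis .
  qed
  note dense = this
  have mono: "variation \<mu> E \<le> variation \<mu> (E \<union> F)" "variation \<mu> F \<le> variation \<mu> (E \<union> F)"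
    by (intro variation_mono; simp)+
  consider "variation \<mu> E = 0" | "variation \<mu> F = 0" | "0 < variation \<mu> E" "0 < variation \<mu> F"
    using zero_less_iff_neq_zero[of "variation \<mu> E"] zero_less_iff_neq_zero[of "variation \<mu> F"]
    by auto
  then show ?thesis
  proof cases
    case 3
    then show ?thesis using ennreal_add_le_dense[OF dense] by blast
  qed (use mono in simp_all)
qed

text \<open>Every partition of the union is refined by its intersections with the \<open>E i\<close>.\<close>

lemma variation_UN_le:
  assumes E: "range E \<subseteq> sets borel" "disjoint_family E"
  shows "variation \<mu> (\<Union>i. E i) \<le> (\<Sum>i. variation \<mu> (E i))"
proof (rule dense_le)
  fix a assume "a < variation \<mu> (\<Union>i. E i)"
  then obtain A n where A: "range A \<subseteq> sets borel" "disjoint_family A" "(\<Union>i. A i) = (\<Union>i. E i)"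
    and less: "a < (\<Sum>j<(n::nat). ennreal (cmod (\<mu> (A j))))"
    by (rule less_variationE)
  have cell: "ennreal (cmod (\<mu> (A j))) \<le> (\<Sum>i. ennreal (cmod (\<mu> (A j \<inter> E i))))" for j
  proof (cases "summable (\<lambda>i. cmod (\<mu> (A j \<inter> E i)))")
    case True
    have "disjoint_family (\<lambda>i. A j \<inter> E i)"
      using E(2) unfolding disjoint_family_on_def by blast
    then have "(\<lambda>i. \<mu> (A j \<inter> E i)) sums \<mu> (\<Union>i. A j \<inter> E i)"
      using A(1) E(1) by (intro complex_measure_sums) auto
    also have "(\<Union>i. A j \<inter> E i) = A j" using A(3) by blast
    finally have "\<mu> (A j) = (\<Sum>i. \<mu> (A j \<inter> E i))" by (rule sums_unique)
    then have "cmod (\<mu> (A j)) \<le> (\<Sum>i. cmod (\<mu> (A j \<inter> E i)))"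
      using summable_norm[OF True] by simp
    then show ?thesis
      using True by (simp add: suminf_ennreal2 ennreal_leI)
  next
    case False
    have "(\<Sum>i. ennreal (cmod (\<mu> (A j \<inter> E i)))) = top"
    proof (rule ccontr)
      assume "\<not> ?thesis"
      then have "summable (\<lambda>i. cmod (\<mu> (A j \<inter> E i)))"
        by (intro summable_suminf_not_top norm_ge_zero)
      with False show False by contradiction
    qed
    then show ?thesis by simp
  qed
  have "(\<Sum>j<n. ennreal (cmod (\<mu> (A j)))) \<le> (\<Sum>j<n. \<Sum>i. ennreal (cmod (\<mu> (A j \<inter> E i))))"
    by (intro sum_mono cell)
  also have "\<dots> = (\<Sum>i. \<Sum>j<n. ennreal (cmod (\<mu> (A j \<inter> E i))))"
    by (rule suminf_sum[symmetric]) auto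
  also have "\<dots> \<le> (\<Sum>i. variation \<mu> (E i))"
  proof (intro suminf_le sum_le_variation)
    show "disjoint_family_on (\<lambda>j. A j \<inter> E i) {..<n}" for i
      using A(2) unfolding disjoint_family_on_def by blast
  qed (use A(1) E(1) in auto)
  finally show "a \<le> (\<Sum>i. variation \<mu> (E i))" using less by simp
qed

lemma variation_empty: "variation \<mu> {} = 0"
proof -
  have "\<not> 0 < variation \<mu> {}"
  proof
    assume "0 < variation \<mu> {}"
    then obtain A n where "(\<Union>i. A i) = {}" "0 < (\<Sum>i<(n::nat). ennreal (cmod (\<mu> (A i))))"
      by (rule less_variationE)
    then show False by (auto simp: complex_measure_empty)
  qed
  then show ?thesis by (simp add: zero_less_iff_neq_zero)
qed

lemma countably_additive_variation: "countably_additive (sets borel) (variation \<mu>)"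
proof (rule countably_additiveI)
  fix E :: "nat \<Rightarrow> real set"
  assume E: "range E \<subseteq> sets borel" "disjoint_family E" "(\<Union>i. E i) \<in> sets borel"
  have "(\<Sum>i<n. variation \<mu> (E i)) \<le> variation \<mu> (\<Union>i<n. E i)" for n
  proof (induction n)
    case (Suc n)
    have "E i \<inter> E n = {}" if "i < n" for i
      using that by (intro disjoint_family_onD[OF E(2)]) auto
    then have disj: "(\<Union>i<n. E i) \<inter> E n = {}" by auto
    have "(\<Sum>i<Suc n. variation \<mu> (E i)) \<le> variation \<mu> (\<Union>i<n. E i) + variation \<mu> (E n)"
      using Suc by (auto intro: add_right_mono)
    also have "\<dots> \<le> variation \<mu> ((\<Union>i<n. E i) \<union> E n)"
      using E(1) by (intro variation_superadditive disj) auto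
    also have "(\<Union>i<n. E i) \<union> E n = (\<Union>i<Suc n. E i)" by (auto simp: less_Suc_eq)
    finally show ?case .
  qed simp
  also have "variation \<mu> (\<Union>i<n. E i) \<le> variation \<mu> (\<Union>i. E i)" for n
    using E by (intro variation_mono) auto
  finally have "(\<Sum>i. variation \<mu> (E i)) \<le> variation \<mu> (\<Union>i. E i)"
    by (simp add: suminf_eq_SUP SUP_le_iff)
  then show "(\<Sum>i. variation \<mu> (E i)) = variation \<mu> (\<Union>i. E i)"
    using variation_UN_le[OF E(1,2)] by simp
qed

lemma space_variation_measure [simp]: "space (variation_measure \<mu>) = UNIV"
  by (simp add: variation_measure_def space_measure_of_conv)

lemma sets_variation_measure [measurable_cong, simp]: "sets (variation_measure \<mu>) = sets borel"
  by (simp add: variation_measure_def) (metis sets.sigma_sets_eq space_borel)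

lemma emeasure_variation_measure:
  assumes "E \<in> sets borel"
  shows "emeasure (variation_measure \<mu>) E = variation \<mu> E"
  unfolding variation_measure_def
proof (rule emeasure_measure_of_sigma[OF _ _ countably_additive_variation assms])
  show "sigma_algebra UNIV (sets borel :: real set set)"
    using sets.sigma_algebra_axioms[of borel] by simp
  show "positive (sets borel) (variation \<mu>)"
    by (simp add: positive_def variation_empty)
qed

text \<open>Of the positive and negative parts of the real and imaginary parts of the values on a
  partition, one accounts for at least a quarter of the sum of absolute values; in the union of the
  cells concerned these contributions do not cancel.\<close>

lemma large_value_if_variation_infinite:
  assumes E: "E \<in> sets borel" and inf: "variation \<mu> E = \<infinity>" and K: "0 \<le> K"
  obtains A where "A \<in> sets borel" "A \<subseteq> E" "K < cmod (\<mu> A)"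
proof -
  have "ennreal (4 * K) < variation \<mu> E" using inf by simp
  then obtain A n where A: "range A \<subseteq> sets borel" "disjoint_family A" "(\<Union>i. A i) = E"
    and less: "ennreal (4 * K) < (\<Sum>i<(n::nat). ennreal (cmod (\<mu> (A i))))"
    by (rule less_variationE)
  have less: "4 * K < (\<Sum>i<n. cmod (\<mu> (A i)))"
    using less K by (simp add: sum_ennreal ennreal_less_iff)
  \<comment> \<open>For \<open>k = 0, 1, 2, 3\<close> these are \<open>Re z\<close>, \<open>- Im z\<close>, \<open>- Re z\<close> and \<open>Im z\<close>.\<close>
  define r where "r k z = Re (\<i> ^ k * z)" for k z
  define J where "J k = {i\<in>{..<n}. 0 < r k (\<mu> (A i))}" for k
  have cmod_le: "cmod z \<le> (\<Sum>k<4. max 0 (r k z))" for z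
    using cmod_le[of z] by (simp add: r_def eval_nat_numeral)
  have "(\<Sum>i<n. cmod (\<mu> (A i))) \<le> (\<Sum>i<n. \<Sum>k<4. max 0 (r k (\<mu> (A i))))"
    by (intro sum_mono cmod_le)
  also have "\<dots> = (\<Sum>k<4. \<Sum>i<n. max 0 (r k (\<mu> (A i))))" by (rule sum.swap)
  also have "\<dots> = (\<Sum>k<4. \<Sum>i\<in>J k. r k (\<mu> (A i)))"
    unfolding J_def by (intro sum.cong refl sum.mono_neutral_cong_right) auto
  finally have total: "4 * K < (\<Sum>k<4. \<Sum>i\<in>J k. r k (\<mu> (A i)))"
    using less by (rule less_le_trans[rotated])
  have "\<exists>k<(4::nat). K < (\<Sum>i\<in>J k. r k (\<mu> (A i)))"
  proof (rule ccontr)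
    assume "\<not> ?thesis"
    then have "(\<Sum>k<(4::nat). \<Sum>i\<in>J k. r k (\<mu> (A i))) \<le> (\<Sum>k<(4::nat). K)"
      by (intro sum_mono) (meson lessThan_iff not_less)
    then show False using total by simp
  qed
  then obtain k where k: "K < (\<Sum>i\<in>J k. r k (\<mu> (A i)))" by blast
  also have "\<dots> = r k (\<Sum>i\<in>J k. \<mu> (A i))"
    by (simp add: r_def sum_distrib_left)
  also have "(\<Sum>i\<in>J k. \<mu> (A i)) = \<mu> (\<Union>i\<in>J k. A i)"
    using A by (intro complex_measure_UN_finite[symmetric]) (auto simp: J_def disjoint_family_on_def)
  also have "r k \<dots> \<le> cmod (\<mu> (\<Union>i\<in>J k. A i))"
    unfolding r_def by (rule order_trans[OF complex_Re_le_cmod]) (simp add: norm_mult norm_power)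
  finally show ?thesis
    using A by (intro that[of "\<Union>i\<in>J k. A i"]) (auto simp: J_def)
qed

text \<open>If \<open>A\<close> carries much more mass than \<open>E\<close>, then so does \<open>E - A\<close> up to sign, and one of the two
  must again have infinite variation.\<close>

lemma infinite_variation_split:
  assumes E: "E \<in> sets borel" and inf: "variation \<mu> E = \<infinity>"
  obtains B where "B \<in> sets borel" "B \<subseteq> E" "variation \<mu> B = \<infinity>" "1 < cmod (\<mu> (E - B))"
proof -
  have "0 \<le> cmod (\<mu> E) + 1" by simp
  then obtain A where A: "A \<in> sets borel" "A \<subseteq> E" and large: "cmod (\<mu> E) + 1 < cmod (\<mu> A)"
    by (rule large_value_if_variation_infinite[OF E inf])
  have 1: "1 < cmod (\<mu> A)" using large norm_ge_zero[of "\<mu> E"] by linarith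
  have "cmod (\<mu> A) \<le> cmod (\<mu> E) + cmod (\<mu> (E - A))"
    using complex_measure_Diff[OF A(1) E A(2)] norm_triangle_ineq4[of "\<mu> E" "\<mu> (E - A)"] by simp
  then have 2: "1 < cmod (\<mu> (E - A))" using large by linarith
  have "emeasure (variation_measure \<mu>) A + emeasure (variation_measure \<mu>) (E - A)
      = emeasure (variation_measure \<mu>) E"
    using A E by (subst plus_emeasure) (auto simp: Un_absorb1)
  then have "variation \<mu> A = \<infinity> \<or> variation \<mu> (E - A) = \<infinity>"
    using A E inf by (simp add: emeasure_variation_measure)
  then show ?thesis
  proof
    assume "variation \<mu> A = \<infinity>"
    then show ?thesis using A 2 by (intro that[of A]) auto
  next
    assume "variation \<mu> (E - A) = \<infinity>"
    moreover have "E - (E - A) = A" using A by blast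
    ultimately show ?thesis using A E 1 by (intro that[of "E - A"]) auto
  qed
qed

text \<open>Otherwise repeated splitting would produce disjoint sets of mass greater than 1 each, and the
  series of their masses would not converge.\<close>

lemma variation_finite: "variation \<mu> UNIV < \<infinity>"
proof (rule ccontr)
  assume "\<not> variation \<mu> UNIV < \<infinity>"
  then have inf: "variation \<mu> UNIV = \<infinity>"
    unfolding infinity_ennreal_def using less_top by blast
  have "\<exists>B. \<forall>n::nat. (B n \<in> sets borel \<and> variation \<mu> (B n) = \<infinity>) \<and>
      (B (Suc n) \<subseteq> B n \<and> 1 < cmod (\<mu> (B n - B (Suc n))))"
  proof (rule dependent_nat_choice)
    show "\<exists>B. B \<in> sets borel \<and> variation \<mu> B = \<infinity>"
      using inf by (intro exI[of _ UNIV]) auto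
    show "\<exists>B'. (B' \<in> sets borel \<and> variation \<mu> B' = \<infinity>) \<and>
        (B' \<subseteq> B \<and> 1 < cmod (\<mu> (B - B')))"
      if "B \<in> sets borel \<and> variation \<mu> B = \<infinity>" for B n
      using infinite_variation_split[of B] that by metis
  qed
  then obtain B where B: "\<And>n::nat. B n \<in> sets borel" "\<And>n. B (Suc n) \<subseteq> B n"
    and large: "\<And>n. 1 < cmod (\<mu> (B n - B (Suc n)))" by blast
  have dec: "B n \<subseteq> B m" if "m \<le> n" for m n
    using lift_Suc_antimono_le[of B, OF B(2) that] .
  have "(B m - B (Suc m)) \<inter> (B n - B (Suc n)) = {}" if "m < n" for m n
    using dec[of "Suc m" n] that by auto
  then have "disjoint_family (\<lambda>n. B n - B (Suc n))"
    unfolding disjoint_family_on_def by (metis Int_commute linorder_neqE_nat)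
  then have "(\<lambda>n. \<mu> (B n - B (Suc n))) sums \<mu> (\<Union>n. B n - B (Suc n))"
    using B by (intro complex_measure_sums) auto
  then have "(\<lambda>n. \<mu> (B n - B (Suc n))) \<longlonglongrightarrow> 0"
    by (rule sums_summable[THEN summable_LIMSEQ_zero])
  then obtain n where "cmod (\<mu> (B n - B (Suc n))) < 1"
    unfolding LIMSEQ_iff by (metis diff_zero le_refl zero_less_one)
  then show False using large[of n] by simp
qed

lemma finite_variation_measure: "finite_measure (variation_measure \<mu>)"
  using variation_finite by (intro finite_measureI) (simp add: emeasure_variation_measure)

section \<open>Integration of bounded limits of simple functions\<close>

text \<open>An elementary integral may be computed on any finer partition, given here by the fibres of \<open>q\<close>.
  Additivity and compatibility with linear maps follow by choosing \<open>q\<close> suitably.\<close>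

lemma simple_integral_wrt_compose:
  fixes \<phi> :: "'b \<Rightarrow> 'a::complex_banach"
  assumes q: "simple_function borel q"
  shows "simple_integral_wrt \<mu> (\<lambda>t. \<phi> (q t)) = (\<Sum>w\<in>range q. \<mu> (q -` {w}) *\<^sub>C \<phi> w)"
proof -
  have fin: "finite (range q)" and meas: "\<And>w. q -` {w} \<in> sets borel"
    using q by (auto simp: simple_function_borel_iff)
  have "\<mu> ((\<lambda>t. \<phi> (q t)) -` {v}) *\<^sub>C v = (\<Sum>w\<in>{w\<in>range q. \<phi> w = v}. \<mu> (q -` {w}) *\<^sub>C \<phi> w)" for v
  proof -
    have "(\<lambda>t. \<phi> (q t)) -` {v} = (\<Union>w\<in>{w\<in>range q. \<phi> w = v}. q -` {w})" by auto
    also have "\<mu> \<dots> = (\<Sum>w\<in>{w\<in>range q. \<phi> w = v}. \<mu> (q -` {w}))"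
      using fin meas by (intro complex_measure_UN_finite) (auto simp: disjoint_family_on_def)
    finally show ?thesis by (simp add: scaleC_sum_left)
  qed
  then have "simple_integral_wrt \<mu> (\<lambda>t. \<phi> (q t))
      = (\<Sum>v\<in>range (\<lambda>t. \<phi> (q t)). \<Sum>w\<in>{w\<in>range q. \<phi> w = v}. \<mu> (q -` {w}) *\<^sub>C \<phi> w)"
    by (simp add: simple_integral_wrt_def)
  also have "\<dots> = (\<Sum>w\<in>range q. \<mu> (q -` {w}) *\<^sub>C \<phi> w)"
    using fin by (intro sum.group) (auto simp: finite_range_imageI)
  finally show ?thesis .
qed

lemma simple_integral_wrt_add_diff:
  fixes s r :: "real \<Rightarrow> 'a::complex_banach"
  assumes "simple_function borel s" "simple_function borel r"
  shows "simple_integral_wrt \<mu> (\<lambda>t. s t + r t) = simple_integral_wrt \<mu> s + simple_integral_wrt \<mu> r"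
    and "simple_integral_wrt \<mu> (\<lambda>t. s t - r t) = simple_integral_wrt \<mu> s - simple_integral_wrt \<mu> r"
proof -
  have q: "simple_function borel (\<lambda>t. (s t, r t))"
    using assms by (rule simple_function_Pair)
  note * = simple_integral_wrt_compose[OF q, of fst] simple_integral_wrt_compose[OF q, of snd]
  show "simple_integral_wrt \<mu> (\<lambda>t. s t + r t) = simple_integral_wrt \<mu> s + simple_integral_wrt \<mu> r"
    using * simple_integral_wrt_compose[OF q, of "\<lambda>(a, b). a + b"]
    by (simp add: case_prod_unfold scaleC_add_right sum.distrib)
  show "simple_integral_wrt \<mu> (\<lambda>t. s t - r t) = simple_integral_wrt \<mu> s - simple_integral_wrt \<mu> r"
    using * simple_integral_wrt_compose[OF q, of "\<lambda>(a, b). a - b"]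
    by (simp add: case_prod_unfold scaleC_diff_right sum_subtractf)
qed

lemma norm_simple_integral_wrt_le:
  fixes s :: "real \<Rightarrow> 'a::complex_banach"
  assumes s: "simple_function borel s"
  shows "ennreal (norm (simple_integral_wrt \<mu> s))
    \<le> (\<integral>\<^sup>+t. ennreal (norm (s t)) \<partial>variation_measure \<mu>)"
proof -
  have fin: "finite (range s)" and meas [measurable]: "\<And>v. s -` {v} \<in> sets borel"
    using s by (auto simp: simple_function_borel_iff)
  have "ennreal (norm (simple_integral_wrt \<mu> s)) \<le> ennreal (\<Sum>v\<in>range s. norm v * cmod (\<mu> (s -` {v})))"
    unfolding simple_integral_wrt_def
    by (intro ennreal_leI order_trans[OF norm_sum]) (simp add: norm_scaleC mult.commute)
  also have "\<dots> = (\<Sum>v\<in>range s. ennreal (norm v) * ennreal (cmod (\<mu> (s -` {v}))))"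
    by (simp add: sum_ennreal[symmetric] ennreal_mult)
  also have "\<dots> \<le> (\<Sum>v\<in>range s. ennreal (norm v) * emeasure (variation_measure \<mu>) (s -` {v}))"
    using meas by (intro sum_mono mult_left_mono)
      (auto simp: emeasure_variation_measure cmod_le_variation)
  also have "\<dots> = (\<integral>\<^sup>+t. (\<Sum>v\<in>range s. ennreal (norm v) * indicator (s -` {v}) t) \<partial>variation_measure \<mu>)"
    by (subst nn_integral_sum) (auto simp: nn_integral_cmult_indicator)
  also have "\<dots> = (\<integral>\<^sup>+t. ennreal (norm (s t)) \<partial>variation_measure \<mu>)"
  proof (rule nn_integral_cong)
    fix t
    have "(\<Sum>v\<in>range s. ennreal (norm v) * indicator (s -` {v}) t)
        = (\<Sum>v\<in>{s t}. ennreal (norm v) * indicator (s -` {v}) t)"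
      using fin by (intro sum.mono_neutral_right) auto
    then show "(\<Sum>v\<in>range s. ennreal (norm v) * indicator (s -` {v}) t) = ennreal (norm (s t))"
      by simp
  qed
  finally show ?thesis .
qed

text \<open>Elementary integrals of functions that approximate \<open>f\<close> in \<open>L\<^sup>1(|\<mu>|)\<close> are close to each other.
  This yields both existence (Cauchy sequences) and uniqueness of the integral.\<close>

lemma simple_integral_wrt_dist_le:
  fixes f :: "real \<Rightarrow> 'a::complex_banach"
  assumes f: "approximable f" and r: "simple_function borel r" and u: "simple_function borel u"
  shows "ennreal (norm (simple_integral_wrt \<mu> r - simple_integral_wrt \<mu> u))
    \<le> (\<integral>\<^sup>+t. ennreal (norm (f t - r t)) \<partial>variation_measure \<mu>)
      + (\<integral>\<^sup>+t. ennreal (norm (f t - u t)) \<partial>variation_measure \<mu>)"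
proof -
  obtain s where s: "bounded_simple_limit s f" using f by (auto simp: approximable_def)
  note [measurable] = bounded_simple_limit_norm_diff_measurable[OF s r]
    bounded_simple_limit_norm_diff_measurable[OF s u]
  have "ennreal (norm (simple_integral_wrt \<mu> r - simple_integral_wrt \<mu> u))
      \<le> (\<integral>\<^sup>+t. ennreal (norm (r t - u t)) \<partial>variation_measure \<mu>)"
    using norm_simple_integral_wrt_le[of "\<lambda>t. r t - u t"] r u
    by (simp add: simple_integral_wrt_add_diff simple_function_compose2[where h="(-)"])
  also have "\<dots> \<le> (\<integral>\<^sup>+t. ennreal (norm (f t - r t)) + ennreal (norm (f t - u t)) \<partial>variation_measure \<mu>)"
  proof (rule nn_integral_mono)
    fix t
    have "norm (r t - u t) \<le> norm (f t - r t) + norm (f t - u t)"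
      using norm_triangle_ineq4[of "f t - u t" "f t - r t"] by simp
    then show "ennreal (norm (r t - u t)) \<le> ennreal (norm (f t - r t)) + ennreal (norm (f t - u t))"
      by (simp add: ennreal_plus[symmetric] ennreal_leI del: ennreal_plus)
  qed
  also have "\<dots> = (\<integral>\<^sup>+t. ennreal (norm (f t - r t)) \<partial>variation_measure \<mu>)
      + (\<integral>\<^sup>+t. ennreal (norm (f t - u t)) \<partial>variation_measure \<mu>)"
    by (rule nn_integral_add) measurable
  finally show ?thesis .
qed

lemma bounded_simple_limit_L1:
  fixes f :: "real \<Rightarrow> 'a::complex_banach"
  assumes s: "bounded_simple_limit s f"
  shows "(\<lambda>n. \<integral>\<^sup>+t. ennreal (norm (f t - s n t)) \<partial>variation_measure \<mu>) \<longlonglongrightarrow> 0"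
proof -
  interpret finite_measure "variation_measure \<mu>" by (rule finite_variation_measure)
  obtain C where C: "\<And>n t. norm (s n t) \<le> C" and lim: "\<And>t. (\<lambda>n. s n t) \<longlonglongrightarrow> f t"
    and simple: "\<And>n. simple_function borel (s n)"
    using s unfolding bounded_simple_limit_def by blast
  have fC: "norm (f t) \<le> C" for t
    using tendsto_norm[OF lim[of t]] by (rule LIMSEQ_le_const2) (use C in auto)
  have "(\<lambda>n. \<integral>\<^sup>+t. ennreal (norm (f t - s n t)) \<partial>variation_measure \<mu>)
      \<longlonglongrightarrow> (\<integral>\<^sup>+t. 0 \<partial>variation_measure \<mu>)"
  proof (rule nn_integral_dominated_convergence[where w="\<lambda>_. ennreal (2 * C)"])
    show "(\<lambda>t. ennreal (norm (f t - s n t))) \<in> borel_measurable (variation_measure \<mu>)" for n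
      using bounded_simple_limit_norm_diff_measurable[OF s simple[of n]] by measurable
    show "AE t in variation_measure \<mu>. ennreal (norm (f t - s n t)) \<le> ennreal (2 * C)" for n
    proof (rule AE_I2, rule ennreal_leI)
      show "norm (f t - s n t) \<le> 2 * C" for t
        using norm_triangle_ineq4[of "f t" "s n t"] fC[of t] C[of n t] by linarith
    qed
    show "(\<integral>\<^sup>+ t. ennreal (2 * C) \<partial>variation_measure \<mu>) < \<infinity>"
      using emeasure_finite[of UNIV, unfolded infinity_ennreal_def less_top] by (simp add: ennreal_mult_less_top)
    show "AE t in variation_measure \<mu>. (\<lambda>n. ennreal (norm (f t - s n t))) \<longlonglongrightarrow> 0"
    proof (rule AE_I2)
      fix t
      have "(\<lambda>n. norm (f t - s n t)) \<longlonglongrightarrow> 0"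
        using tendsto_norm[OF tendsto_diff[OF tendsto_const lim[of t], of "f t"]] by simp
      then show "(\<lambda>n. ennreal (norm (f t - s n t))) \<longlonglongrightarrow> 0"
        using tendsto_ennrealI by fastforce
    qed
  qed auto
  then show ?thesis by simp
qed

text \<open>The definition of the integral allows arbitrary \<open>L\<^sup>1\<close> approximations, but all of them lead to the
  same value. One that converges pointwise and boundedly thus computes it, and every rule for integrals below reduces to
  the corresponding rule for elementary integrals.\<close>

lemma integral_wrt_LIMSEQ:
  fixes f :: "real \<Rightarrow> 'a::complex_banach"
  assumes s: "bounded_simple_limit s f"
  shows "(\<lambda>n. simple_integral_wrt \<mu> (s n)) \<longlonglongrightarrow> integral_wrt \<mu> f"
proof -
  let ?V = "variation_measure \<mu>"
  have f: "approximable f" using s by (auto simp: approximable_def)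
  have simple: "\<And>n. simple_function borel (s n)" using s unfolding bounded_simple_limit_def by blast
  note V_iff = simple_function_cong_borel[OF space_variation_measure sets_variation_measure]
  have sL1: "(\<lambda>n. \<integral>\<^sup>+t. ennreal (norm (f t - s n t)) \<partial>?V) \<longlonglongrightarrow> 0"
    using s by (rule bounded_simple_limit_L1)
  have "Cauchy (\<lambda>n. simple_integral_wrt \<mu> (s n))"
  proof (rule CauchyI)
    fix e :: real assume e: "0 < e"
    have "\<forall>\<^sub>F n in sequentially. (\<integral>\<^sup>+t. ennreal (norm (f t - s n t)) \<partial>?V) < ennreal (e / 2)"
      using sL1 e by (intro order_tendstoD(2)) auto
    then obtain N where N: "\<And>n. N \<le> n \<Longrightarrow> (\<integral>\<^sup>+t. ennreal (norm (f t - s n t)) \<partial>?V) < ennreal (e / 2)"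
      by (auto simp: eventually_sequentially)
    have "norm (simple_integral_wrt \<mu> (s m) - simple_integral_wrt \<mu> (s n)) < e"
      if "N \<le> m" "N \<le> n" for m n
    proof -
      have "ennreal (norm (simple_integral_wrt \<mu> (s m) - simple_integral_wrt \<mu> (s n)))
          < ennreal (e / 2) + ennreal (e / 2)"
        using simple_integral_wrt_dist_le[OF f simple simple, of m n] N[OF that(1)] N[OF that(2)]
        by (meson add_strict_mono le_less_trans)
      also have "\<dots> = ennreal e" using e by (simp add: ennreal_plus[symmetric] del: ennreal_plus)
      finally show ?thesis using e by (simp add: ennreal_less_iff)
    qed
    then show "\<exists>N. \<forall>m\<ge>N. \<forall>n\<ge>N.
        norm (simple_integral_wrt \<mu> (s m) - simple_integral_wrt \<mu> (s n)) < e" by blast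
  qed
  then obtain y where y: "(\<lambda>n. simple_integral_wrt \<mu> (s n)) \<longlonglongrightarrow> y"
    using Cauchy_convergent_iff convergent_def by blast
  have "strongly_measurable ?V f"
    using s unfolding strongly_measurable_def bounded_simple_limit_def by (auto simp: V_iff)
  then have has: "has_integral_wrt \<mu> f y"
    unfolding has_integral_wrt_def using sL1 y simple by (auto simp: V_iff)
  have "z = y" if z: "has_integral_wrt \<mu> f z" for z
  proof -
    obtain r where r: "\<And>n. simple_function borel (r n)"
      and rL1: "(\<lambda>n. \<integral>\<^sup>+t. ennreal (norm (f t - r n t)) \<partial>?V) \<longlonglongrightarrow> 0"
      and rz: "(\<lambda>n. simple_integral_wrt \<mu> (r n)) \<longlonglongrightarrow> z"
      using z unfolding has_integral_wrt_def V_iff by blast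
    have "(\<lambda>n. ennreal (norm (simple_integral_wrt \<mu> (r n) - simple_integral_wrt \<mu> (s n))))
        \<longlonglongrightarrow> ennreal (norm (z - y))"
      by (intro tendsto_intros rz y)
    moreover have "(\<lambda>n. (\<integral>\<^sup>+t. ennreal (norm (f t - r n t)) \<partial>?V)
        + (\<integral>\<^sup>+t. ennreal (norm (f t - s n t)) \<partial>?V)) \<longlonglongrightarrow> 0"
      using tendsto_add[OF rL1 sL1] by simp
    ultimately have "ennreal (norm (z - y)) \<le> 0"
      by (rule LIMSEQ_le) (use simple_integral_wrt_dist_le[OF f r simple] in blast)
    then show ?thesis by simp
  qed
  with has have "(THE z. has_integral_wrt \<mu> f z) = y" by (rule the_equality)
  then have "integral_wrt \<mu> f = y"
    unfolding integral_wrt_def using has by metis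
  then show ?thesis using y by simp
qed

lemma integral_wrt_add:
  fixes f g :: "real \<Rightarrow> 'a::complex_banach"
  assumes "approximable f" "approximable g"
  shows "integral_wrt \<mu> (\<lambda>t. f t + g t) = integral_wrt \<mu> f + integral_wrt \<mu> g"
proof -
  obtain s r where s: "bounded_simple_limit s f" and r: "bounded_simple_limit r g"
    using assms by (auto simp: approximable_def)
  have simple: "simple_function borel (s n)" "simple_function borel (r n)" for n
    using s r unfolding bounded_simple_limit_def by blast+
  have "(\<lambda>n. simple_integral_wrt \<mu> (s n) + simple_integral_wrt \<mu> (r n)) \<longlonglongrightarrow> integral_wrt \<mu> (\<lambda>t. f t + g t)"
    using integral_wrt_LIMSEQ[OF bounded_simple_limit_add[OF s r]] simple
    by (simp add: simple_integral_wrt_add_diff)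
  moreover have "(\<lambda>n. simple_integral_wrt \<mu> (s n) + simple_integral_wrt \<mu> (r n))
      \<longlonglongrightarrow> integral_wrt \<mu> f + integral_wrt \<mu> g"
    by (intro tendsto_add integral_wrt_LIMSEQ s r)
  ultimately show ?thesis by (rule LIMSEQ_unique)
qed

lemma integral_wrt_bounded_linear:
  fixes f :: "real \<Rightarrow> 'a::complex_banach" and B :: "'a \<Rightarrow> 'b::complex_banach"
  assumes "approximable f" and B: "bounded_linear B" and hom: "\<And>z v. B (z *\<^sub>C v) = z *\<^sub>C B v"
  shows "integral_wrt \<mu> (\<lambda>t. B (f t)) = B (integral_wrt \<mu> f)"
proof -
  interpret B: bounded_linear B by fact
  obtain s C where s: "bounded_simple_limit s f" and C: "\<And>n t. norm (s n t) \<le> C"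
    using assms by (auto simp: approximable_def bounded_simple_limit_def)
  obtain K where K: "0 < K" "\<And>v. norm (B v) \<le> norm v * K" using B.pos_bounded by blast
  have simple: "simple_function borel (s n)" for n
    using s unfolding bounded_simple_limit_def by blast
  have "norm (B (s n t)) \<le> C * K" for n t
    using K(2)[of "s n t"] mult_right_mono[OF C[of n t], of K] K(1) by linarith
  then have "bounded_simple_limit (\<lambda>n t. B (s n t)) (\<lambda>t. B (f t))"
    using s unfolding bounded_simple_limit_def
    by (auto intro: simple_function_compose1[where g=B] B.tendsto)
  then have "(\<lambda>n. simple_integral_wrt \<mu> (\<lambda>t. B (s n t))) \<longlonglongrightarrow> integral_wrt \<mu> (\<lambda>t. B (f t))"
    by (rule integral_wrt_LIMSEQ)
  moreover have "simple_integral_wrt \<mu> (\<lambda>t. B (s n t)) = B (simple_integral_wrt \<mu> (s n))" for n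
    by (simp add: simple_integral_wrt_compose[OF simple] simple_integral_wrt_def[of _ "s n"] B.sum hom)
  ultimately have "(\<lambda>n. B (simple_integral_wrt \<mu> (s n))) \<longlonglongrightarrow> integral_wrt \<mu> (\<lambda>t. B (f t))" by simp
  then show ?thesis
    using B.tendsto[OF integral_wrt_LIMSEQ[OF s]] by (rule LIMSEQ_unique)
qed

lemma norm_integral_wrt_le:
  fixes f :: "real \<Rightarrow> 'a::complex_banach"
  assumes f: "approximable f"
  shows "ennreal (norm (integral_wrt \<mu> f)) \<le> (\<integral>\<^sup>+t. ennreal (norm (f t)) \<partial>variation_measure \<mu>)"
proof -
  obtain s where s: "bounded_simple_limit s f" using f by (auto simp: approximable_def)
  have simple: "simple_function borel (s n)" for n
    using s unfolding bounded_simple_limit_def by blast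
  have "(\<lambda>n. ennreal (norm (simple_integral_wrt \<mu> (s n)))) \<longlonglongrightarrow> ennreal (norm (integral_wrt \<mu> f))"
    by (intro tendsto_intros integral_wrt_LIMSEQ s)
  moreover have "(\<lambda>n. (\<integral>\<^sup>+t. ennreal (norm (f t - s n t)) \<partial>variation_measure \<mu>)
      + (\<integral>\<^sup>+t. ennreal (norm (f t)) \<partial>variation_measure \<mu>))
      \<longlonglongrightarrow> 0 + (\<integral>\<^sup>+t. ennreal (norm (f t)) \<partial>variation_measure \<mu>)"
    by (intro tendsto_add bounded_simple_limit_L1 s tendsto_const)
  ultimately have "ennreal (norm (integral_wrt \<mu> f))
      \<le> 0 + (\<integral>\<^sup>+t. ennreal (norm (f t)) \<partial>variation_measure \<mu>)"
  proof (rule LIMSEQ_le, intro exI allI impI)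
    fix n
    have "simple_integral_wrt \<mu> (\<lambda>_::real. 0 :: 'a) = 0" by (simp add: simple_integral_wrt_def)
    then show "ennreal (norm (simple_integral_wrt \<mu> (s n)))
        \<le> (\<integral>\<^sup>+t. ennreal (norm (f t - s n t)) \<partial>variation_measure \<mu>)
          + (\<integral>\<^sup>+t. ennreal (norm (f t)) \<partial>variation_measure \<mu>)"
      using simple_integral_wrt_dist_le[OF f simple[of n], of "\<lambda>_. 0"] by simp
  qed
  then show ?thesis by simp
qed

lemma integral_wrt_reflect:
  fixes f :: "real \<Rightarrow> 'a::complex_banach"
  assumes even: "\<And>E. E \<in> sets borel \<Longrightarrow> \<mu> (uminus ` E) = \<mu> E" and f: "approximable f"
  shows "approximable (\<lambda>t. f (- t))" and "integral_wrt \<mu> (\<lambda>t. f (- t)) = integral_wrt \<mu> f"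
proof -
  obtain s where s: "bounded_simple_limit s f" using f by (auto simp: approximable_def)
  have reflect: "uminus ` E = {t. - t \<in> E}" for E :: "real set"
  proof (intro set_eqI iffI)
    show "t \<in> uminus ` E" if "t \<in> {t. - t \<in> E}" for t
      using that by (intro image_eqI[of _ _ "- t"]) simp_all
  qed auto
  have range: "range (\<lambda>t. r (- t)) = range r" for r :: "real \<Rightarrow> 'a"
  proof -
    have "range (\<lambda>t. r (- t)) = r ` range uminus" by (simp only: image_image)
    then show ?thesis by (simp only: surj_uminus)
  qed
  have vimage: "(\<lambda>t. r (- t)) -` X = uminus ` (r -` X)" for r :: "real \<Rightarrow> 'a" and X
    by (simp add: reflect vimage_def)
  have simple: "simple_function borel (s n)" for n
    using s unfolding bounded_simple_limit_def by blast
  have "uminus ` E \<in> sets borel" if [measurable]: "E \<in> sets borel" for E :: "real set"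
    unfolding reflect by measurable
  then have "simple_function borel (\<lambda>t. s n (- t))" for n
    using simple[of n] by (simp add: simple_function_borel_iff range vimage)
  then have s': "bounded_simple_limit (\<lambda>n t. s n (- t)) (\<lambda>t. f (- t))"
    using s unfolding bounded_simple_limit_def by blast
  then show "approximable (\<lambda>t. f (- t))" unfolding approximable_def by blast
  have "simple_integral_wrt \<mu> (\<lambda>t. s n (- t)) = simple_integral_wrt \<mu> (s n)" for n
    using simple[of n] even by (simp add: simple_integral_wrt_def range vimage simple_function_borel_iff)
  then show "integral_wrt \<mu> (\<lambda>t. f (- t)) = integral_wrt \<mu> f"
    using integral_wrt_LIMSEQ[OF s] integral_wrt_LIMSEQ[OF s'] LIMSEQ_unique by auto
qed

end

section \<open>Averaging in \<open>L\<^sup>p\<close>\<close>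

lemma powr_weighted_mean_le:
  fixes p a b u v :: real
  assumes p: "1 \<le> p" and ab: "0 \<le> a" "0 \<le> b" "a + b = 1" and uv: "0 \<le> u" "0 \<le> v"
  shows "(a * u + b * v) powr p \<le> a * u powr p + b * v powr p"
proof -
  have scale: "(c * w) powr p \<le> c * w powr p" if "0 \<le> c" "c \<le> 1" "0 \<le> w" for c w :: real
  proof -
    have "c powr p \<le> c powr 1" using that p by (intro powr_mono') auto
    then show ?thesis using that by (simp add: powr_mult mult_right_mono)
  qed
  consider "u = 0" | "v = 0" | "0 < u" "0 < v" using uv by linarith
  then show ?thesis
  proof cases
    case 1 then show ?thesis using scale[of b v] ab uv p by simp
  next
    case 2 then show ?thesis using scale[of a u] ab uv p by simp
  next
    case 3
    have "1 - b = a" "b \<le> 1" using ab by simp_all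
    with 3 show ?thesis
      using convex_onD[OF powr_convex[OF p], of b u v] ab(2) by simp
  qed
qed

lemma nn_integral_powr_le_if_Lp_norm_le:
  assumes p: "1 \<le> p" and L: "0 \<le> L" and le: "Lp_norm p f \<le> ennreal L"
  shows "(\<integral>\<^sup>+t. ennreal (norm (f t) powr p) \<partial>lborel) \<le> ennreal (L powr p)"
proof -
  let ?I = "\<integral>\<^sup>+t. ennreal (norm (f t) powr p) \<partial>lborel"
  have fin: "?I \<noteq> \<infinity>" using le by (auto simp: Lp_norm_def Let_def top_unique)
  then have "enn2real ?I powr (1 / p) \<le> L"
    using le L by (simp add: Lp_norm_def Let_def)
  then have "(enn2real ?I powr (1 / p)) powr p \<le> L powr p"
    using p by (intro powr_mono2) auto
  then have "enn2real ?I \<le> L powr p" using p by (simp add: powr_powr)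
  then show ?thesis
    using fin by (metis ennreal_enn2real ennreal_leI infinity_ennreal_def less_top)
qed

lemma Lp_norm_le_1:
  assumes "(\<integral>\<^sup>+t. ennreal (norm (f t) powr p) \<partial>lborel) \<le> 1" "0 < p"
  shows "Lp_norm p f \<le> 1"
proof -
  let ?I = "\<integral>\<^sup>+t. ennreal (norm (f t) powr p) \<partial>lborel"
  have "?I \<noteq> top" using assms(1) by (metis ennreal_one_neq_top top_unique)
  moreover have "enn2real ?I \<le> 1" using assms(1) by (simp add: enn2real_leI)
  then have "enn2real ?I powr (1 / p) \<le> 1" using assms(2) by (intro powr_le1) auto
  ultimately show ?thesis by (simp add: Lp_norm_def Let_def)
qed

text \<open>Integrating \<open>c \<le> 2M h(t) + h(2t)\<close> over \<open>[-N, N]\<close>: after division by \<open>2M + 1\<close> the right-hand side is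
  a weighted mean, so it may be raised to the \<open>p\<close>-th power termwise. The substitution \<open>t \<mapsto> 2t\<close>
  gains a factor \<open>1/2\<close> for the second term, whence \<open>2M + 1/2 = (4M + 1)/2\<close> in the numerator.\<close>

lemma two_scale_average:
  fixes h :: "real \<Rightarrow> real" and c M N p J :: real
  assumes p: "1 \<le> p" and M: "0 \<le> M" and N: "0 \<le> N" and c: "0 \<le> c" and J: "0 \<le> J"
    and h [measurable]: "h \<in> borel_measurable borel" and h0: "\<And>t. 0 \<le> h t"
    and le: "\<And>t. \<bar>t\<bar> \<le> N \<Longrightarrow> c \<le> 2 * M * h t + h (2 * t)"
    and int: "(\<integral>\<^sup>+t. ennreal (h t powr p) \<partial>lborel) \<le> ennreal J"
  shows "2 * N * (c / (2 * M + 1)) powr p \<le> (4 * M + 1) / (2 * (2 * M + 1)) * J"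
proof -
  define a where "a = 2 * M / (2 * M + 1)"
  define b where "b = 1 / (2 * M + 1)"
  have ab: "0 \<le> a" "0 \<le> b" "a + b = 1" using M by (auto simp: a_def b_def field_simps)
  have point: "(c / (2 * M + 1)) powr p \<le> a * h t powr p + b * h (2 * t) powr p" if "\<bar>t\<bar> \<le> N" for t
  proof -
    have "c / (2 * M + 1) \<le> a * h t + b * h (2 * t)"
      using le[OF that] M by (simp add: a_def b_def divide_right_mono add_divide_distrib[symmetric])
    then have "(c / (2 * M + 1)) powr p \<le> (a * h t + b * h (2 * t)) powr p"
      using p c M by (intro powr_mono2) auto
    also have "\<dots> \<le> a * h t powr p + b * h (2 * t) powr p"
      using p ab h0 by (intro powr_weighted_mean_le)
    finally show ?thesis .
  qed
  have "ennreal (2 * N * (c / (2 * M + 1)) powr p)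
      = (\<integral>\<^sup>+t. ennreal ((c / (2 * M + 1)) powr p) * indicator {-N..N} t \<partial>lborel)"
    using N by (subst nn_integral_cmult_indicator) (auto simp: ennreal_mult[symmetric] mult.commute)
  also have "\<dots> \<le> (\<integral>\<^sup>+t. ennreal a * ennreal (h t powr p) + ennreal b * ennreal (h (2 * t) powr p) \<partial>lborel)"
    using point ab by (intro nn_integral_mono)
      (auto simp: ennreal_mult[symmetric] ennreal_plus[symmetric] abs_le_iff simp del: ennreal_plus
        intro!: ennreal_leI split: split_indicator)
  also have "\<dots> = ennreal a * (\<integral>\<^sup>+t. ennreal (h t powr p) \<partial>lborel)
      + ennreal b * (\<integral>\<^sup>+t. ennreal (h (2 * t) powr p) \<partial>lborel)"
    by (simp add: nn_integral_add nn_integral_cmult)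
  also have "(\<integral>\<^sup>+t. ennreal (h (2 * t) powr p) \<partial>lborel)
      = ennreal (1 / 2) * (\<integral>\<^sup>+t. ennreal (h t powr p) \<partial>lborel)"
  proof -
    have "ennreal (1 / 2) * (\<integral>\<^sup>+t. ennreal (h t powr p) \<partial>lborel)
        = (ennreal (1 / 2) * ennreal 2) * (\<integral>\<^sup>+t. ennreal (h (2 * t) powr p) \<partial>lborel)"
      using nn_integral_real_affine[of "\<lambda>t. ennreal (h t powr p)" 2 0] by (simp add: mult.assoc)
    also have "ennreal (1 / 2) * ennreal 2 = ennreal (1 / 2 * 2)" by (rule ennreal_mult[symmetric]) simp_all
    finally show ?thesis by simp
  qed
  also have "ennreal a * (\<integral>\<^sup>+t. ennreal (h t powr p) \<partial>lborel)
      + ennreal b * (ennreal (1 / 2) * (\<integral>\<^sup>+t. ennreal (h t powr p) \<partial>lborel))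
      \<le> ennreal a * ennreal J + ennreal b * (ennreal (1 / 2) * ennreal J)"
    by (intro add_mono mult_left_mono int) auto
  also have "\<dots> = ennreal (a * J + b * (1 / 2 * J))"
    by (simp only: ennreal_mult[symmetric] ennreal_plus[symmetric] mult_nonneg_nonneg ab J
        zero_le_divide_1_iff zero_le_numeral)
  finally have "2 * N * (c / (2 * M + 1)) powr p \<le> a * J + b * (1 / 2 * J)"
    using ab J by (subst (asm) ennreal_le_iff) auto
  also have "\<dots> = (4 * M + 1) / (2 * (2 * M + 1)) * J"
  proof -
    have *: "2 * M / d * J + 1 / d * (1 / 2 * J) = (4 * M + 1) / (2 * d) * J" if "0 < d" for d
      using that by (simp add: field_simps)
    show ?thesis unfolding a_def b_def by (rule *) (use M in simp)
  qed
  finally show ?thesis .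
qed

section \<open>Cosine functions and convolution\<close>

text \<open>The convolution of \<open>f\<close> is not known to be measurable, so its norm is bounded below by a measurable
  \<open>h\<close>. Rescaling \<open>f\<close> to norm at most 1 makes the operator norm applicable.\<close>

lemma Lp_onorm_convolution_lower_bound:
  fixes f :: "real \<Rightarrow> 'a::complex_banach"
  assumes \<mu>: "complex_borel_measure \<mu>" and p: "1 \<le> p" and L: "0 \<le> L" and K: "0 < K"
    and onorm: "Lp_onorm p (convolution \<mu> :: (real \<Rightarrow> 'a) \<Rightarrow> real \<Rightarrow> 'a) \<le> ennreal L"
    and f: "approximable f" "\<And>t. approximable (\<lambda>s. f (t - s))"
    and fK: "(\<integral>\<^sup>+t. ennreal (norm (f t) powr p) \<partial>lborel) \<le> ennreal (K powr p)"
    and h [measurable]: "h \<in> borel_measurable borel" and h0: "\<And>t. 0 \<le> h t"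
    and h_le: "\<And>t. h t \<le> norm (convolution \<mu> f t)"
  shows "(\<integral>\<^sup>+t. ennreal (h t powr p) \<partial>lborel) \<le> ennreal ((L * K) powr p)"
proof -
  note [measurable] = approximable_norm_measurable[OF f(1)]
  define g where "g t = (1 / K) *\<^sub>R f t" for t
  have scale: "(\<integral>\<^sup>+t. ennreal ((1 / K * u t) powr p) \<partial>lborel)
      = ennreal (K powr - p) * (\<integral>\<^sup>+t. ennreal (u t powr p) \<partial>lborel)"
    if [measurable]: "u \<in> borel_measurable borel" and "\<And>t. 0 \<le> u t" for u :: "real \<Rightarrow> real"
  proof -
    have "(1 / K * u t) powr p = K powr - p * u t powr p" for t
      using K that(2) by (simp add: powr_mult powr_divide powr_minus_divide)
    then show ?thesis by (simp add: ennreal_mult nn_integral_cmult)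
  qed
  have "(\<integral>\<^sup>+t. ennreal (norm (g t) powr p) \<partial>lborel)
      = ennreal (K powr - p) * (\<integral>\<^sup>+t. ennreal (norm (f t) powr p) \<partial>lborel)"
    using scale[of "\<lambda>t. norm (f t)"] K by (simp add: g_def)
  also have "\<dots> \<le> ennreal (K powr - p) * ennreal (K powr p)"
    by (intro mult_left_mono fK) simp
  also have "\<dots> = 1" using K by (simp add: ennreal_mult[symmetric] powr_add[symmetric])
  finally have g1: "Lp_norm p g \<le> 1" using p by (intro Lp_norm_le_1) auto
  have "approximable g"
    unfolding g_def using f(1)
    by (rule approximable_compose[where K="1 / K"]) (use K in \<open>auto intro!: continuous_intros\<close>)
  then have "g \<in> Lp_space p"
    using g1 by (auto simp: Lp_space_def strongly_measurable_lborel_if_approximable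
      intro: le_less_trans)
  then have "Lp_norm p (convolution \<mu> g) \<le> Lp_onorm p (convolution \<mu> :: (real \<Rightarrow> 'a) \<Rightarrow> real \<Rightarrow> 'a)"
    unfolding Lp_onorm_def using g1 by (intro SUP_upper) auto
  then have conv: "(\<integral>\<^sup>+t. ennreal (norm (convolution \<mu> g t) powr p) \<partial>lborel) \<le> ennreal (L powr p)"
    using onorm by (intro nn_integral_powr_le_if_Lp_norm_le p L) (rule order_trans)
  have commute: "r *\<^sub>R z *\<^sub>C v = z *\<^sub>C r *\<^sub>R v" for r z and v :: 'a
    by (simp add: scaleC_of_real[symmetric] scaleC_scaleC mult.commute)
  have "convolution \<mu> g t = (1 / K) *\<^sub>R convolution \<mu> f t" for t
    unfolding convolution_def g_def
    by (rule integral_wrt_bounded_linear[OF \<mu> f(2) bounded_linear_scaleR_right commute])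
  then have "(1 / K * h t) powr p \<le> norm (convolution \<mu> g t) powr p" for t
    using h_le[of t] h0[of t] K p by (intro powr_mono2) (auto simp: divide_right_mono)
  then have "(\<integral>\<^sup>+t. ennreal ((1 / K * h t) powr p) \<partial>lborel)
      \<le> (\<integral>\<^sup>+t. ennreal (norm (convolution \<mu> g t) powr p) \<partial>lborel)"
    by (intro nn_integral_mono ennreal_leI)
  then have "ennreal (K powr - p) * (\<integral>\<^sup>+t. ennreal (h t powr p) \<partial>lborel) \<le> ennreal (L powr p)"
    using scale[OF h h0] conv by simp
  then have "ennreal (K powr p) * (ennreal (K powr - p) * (\<integral>\<^sup>+t. ennreal (h t powr p) \<partial>lborel))
      \<le> ennreal (K powr p) * ennreal (L powr p)"
    by (rule mult_left_mono) simp
  moreover have "ennreal (K powr p) * ennreal (K powr - p) = 1"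
    using K by (simp add: ennreal_mult[symmetric] powr_add[symmetric])
  ultimately show ?thesis
    using K L by (simp add: mult.assoc[symmetric] ennreal_mult[symmetric] powr_mult mult.commute)
qed

context
  fixes Cos :: "real \<Rightarrow> 'a::complex_banach \<Rightarrow>\<^sub>L 'a" and M :: real
  assumes cos: "cosine_function Cos" and M: "\<And>t. norm (Cos t) \<le> M"
begin

lemma cosine_0: "Cos 0 x = x"
  using cos by (simp add: cosine_function_def)

lemma cosine_mult: "2 *\<^sub>R Cos t (Cos s x) = Cos (t + s) x + Cos (t - s) x"
proof -
  have "Cos (t + s) + Cos (t - s) = 2 *\<^sub>R (Cos t o\<^sub>L Cos s)"
    using cos unfolding cosine_function_def by blast
  then have "blinfun_apply (Cos (t + s) + Cos (t - s)) x = blinfun_apply (2 *\<^sub>R (Cos t o\<^sub>L Cos s)) x"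
    by simp
  then show ?thesis by (simp add: plus_blinfun.rep_eq scaleR_blinfun.rep_eq)
qed

lemma norm_cosine_le: "norm (Cos t x) \<le> M * norm x"
  using norm_blinfun[of "Cos t" x] mult_right_mono[OF M[of t] norm_ge_zero[of x]] by linarith

lemma continuous_on_cosine:
  assumes "continuous_on UNIV g"
  shows "continuous_on UNIV (\<lambda>t. Cos (g t) x)"
proof -
  have "continuous_on UNIV (\<lambda>t. Cos t x)"
    using cos unfolding cosine_function_def by blast
  then show ?thesis using assms by (rule continuous_on_compose2) simp
qed

lemma approximable_cosine:
  "continuous_on UNIV g \<Longrightarrow> approximable (\<lambda>t. Cos (g t) x)"
  by (intro approximable_continuous[where C="M * norm x"] continuous_on_cosine norm_cosine_le)

text \<open>This is \<open>y = 2 Cos(t)\<^sup>2 y - Cos(2t) y\<close>: one cannot bound \<open>y\<close> by \<open>Cos t y\<close> alone, since \<open>Cos t\<close> may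
  have a kernel, but \<open>Cos t y\<close> and \<open>Cos (2t) y\<close> cannot both be small.\<close>

lemma norm_le_cosine_double: "norm y \<le> 2 * M * norm (Cos t y) + norm (Cos (2 * t) y)"
proof -
  have eq: "2 *\<^sub>R Cos t (Cos t y) - Cos (2 * t) y = y"
    unfolding cosine_mult mult_2 by (simp add: cosine_0)
  have "norm y \<le> norm (2 *\<^sub>R Cos t (Cos t y)) + norm (Cos (2 * t) y)"
    using norm_triangle_ineq4[of "2 *\<^sub>R Cos t (Cos t y)" "Cos (2 * t) y"] unfolding eq .
  also have "norm (2 *\<^sub>R Cos t (Cos t y)) \<le> 2 * (M * norm (Cos t y))"
    using norm_cosine_le[of t "Cos t y"] by simp
  finally show ?thesis by simp
qed

text \<open>Multiplying by \<open>Cos t\<close> under the integral gives the mean of \<open>Cos (t + s) x\<close> and \<open>Cos (t - s) x\<close>;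
  reflection in \<open>s\<close> exchanges the two and preserves \<open>\<mu>\<close>.\<close>

lemma cosine_cos_transform:
  assumes "\<mu> \<in> even_measures"
  shows "Cos t (cos_transform Cos \<mu> x) = integral_wrt \<mu> (\<lambda>s. Cos (t - s) x)"
proof -
  have \<mu>: "complex_borel_measure \<mu>" and even: "\<And>E. E \<in> sets borel \<Longrightarrow> \<mu> (uminus ` E) = \<mu> E"
    using assms by (auto simp: even_measures_def regular_measures_def)
  let ?F = "\<lambda>s. Cos (t - s) x"
  have F: "approximable ?F" by (intro approximable_cosine continuous_intros)
  have hom: "2 *\<^sub>R Cos t (z *\<^sub>C v) = z *\<^sub>C 2 *\<^sub>R Cos t v" for z v
    using cos unfolding cosine_function_def
    by (simp add: scaleC_of_real[symmetric] scaleC_scaleC mult.commute)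
  have "2 *\<^sub>R Cos t (cos_transform Cos \<mu> x) = integral_wrt \<mu> (\<lambda>s. 2 *\<^sub>R Cos t (Cos s x))"
    unfolding cos_transform_def
    by (rule integral_wrt_bounded_linear[OF \<mu>, where B="\<lambda>v. 2 *\<^sub>R Cos t v", symmetric])
      (auto intro!: approximable_cosine continuous_intros bounded_linear_intros simp: hom)
  also have "\<dots> = integral_wrt \<mu> (\<lambda>s. ?F (- s) + ?F s)"
    by (simp add: cosine_mult)
  also have "\<dots> = integral_wrt \<mu> (\<lambda>s. ?F (- s)) + integral_wrt \<mu> ?F"
    by (intro integral_wrt_add[OF \<mu>] integral_wrt_reflect(1)[OF \<mu> even] F)
  also have "\<dots> = 2 *\<^sub>R integral_wrt \<mu> ?F"
    using integral_wrt_reflect(2)[OF \<mu> even F] by (simp add: scaleR_2)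
  finally show ?thesis by simp
qed

text \<open>For \<open>|t| + a \<le> R\<close> the truncation affects \<open>Cos (t - s) x\<close> only where \<open>|s| > a\<close>.\<close>

lemma cosine_cos_transform_truncated:
  assumes \<mu>: "\<mu> \<in> even_measures" and t: "\<bar>t\<bar> + a \<le> R"
  shows "ennreal (norm (Cos t (cos_transform Cos \<mu> x)
      - convolution \<mu> (\<lambda>s. indicator {-R..R} s *\<^sub>R Cos s x) t))
    \<le> ennreal (M * norm x) * emeasure (variation_measure \<mu>) {s. a < \<bar>s\<bar>}"
proof -
  have \<mu>': "complex_borel_measure \<mu>"
    using \<mu> by (auto simp: even_measures_def regular_measures_def)
  define A where "A = {t - R..t + R}"
  let ?F = "\<lambda>s. Cos (t - s) x"
  have F: "approximable ?F" by (intro approximable_cosine continuous_intros)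
  have ind: "indicat_real {-R..R} (t - s) = indicator A s" for s
    by (auto simp: A_def indicator_def)
  have split: "?F s = indicator A s *\<^sub>R ?F s + indicator (- A) s *\<^sub>R ?F s" for s
    by (auto simp: indicator_def)
  have outer: "approximable (\<lambda>s. indicator (- A) s *\<^sub>R ?F s)"
    by (intro approximable_indicator F) (auto simp: A_def)
  have "integral_wrt \<mu> ?F = integral_wrt \<mu> (\<lambda>s. indicator A s *\<^sub>R ?F s)
      + integral_wrt \<mu> (\<lambda>s. indicator (- A) s *\<^sub>R ?F s)"
    by (subst split, intro integral_wrt_add[OF \<mu>'] outer approximable_indicator F) (simp add: A_def)
  then have "Cos t (cos_transform Cos \<mu> x) - convolution \<mu> (\<lambda>s. indicator {-R..R} s *\<^sub>R Cos s x) t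
      = integral_wrt \<mu> (\<lambda>s. indicator (- A) s *\<^sub>R ?F s)"
    by (simp add: cosine_cos_transform[OF \<mu>] convolution_def ind)
  then have "ennreal (norm (Cos t (cos_transform Cos \<mu> x)
      - convolution \<mu> (\<lambda>s. indicator {-R..R} s *\<^sub>R Cos s x) t))
      \<le> (\<integral>\<^sup>+s. ennreal (norm (indicat_real (- A) s *\<^sub>R ?F s)) \<partial>variation_measure \<mu>)"
    using norm_integral_wrt_le[OF \<mu>' outer] by simp
  also have "\<dots> \<le> (\<integral>\<^sup>+s. ennreal (M * norm x) * indicator {s. a < \<bar>s\<bar>} s \<partial>variation_measure \<mu>)"
  proof (rule nn_integral_mono)
    fix s
    have "s \<in> A" if "\<bar>s\<bar> \<le> a" using that t by (auto simp: A_def)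
    then show "ennreal (norm (indicat_real (- A) s *\<^sub>R ?F s))
        \<le> ennreal (M * norm x) * indicator {s. a < \<bar>s\<bar>} s"
      using norm_cosine_le[of "t - s" x] by (auto simp: indicator_def not_less intro: ennreal_leI)
  qed
  also have "\<dots> = ennreal (M * norm x) * emeasure (variation_measure \<mu>) {s. a < \<bar>s\<bar>}"
    by (rule nn_integral_cmult_indicator) (simp add: sets_variation_measure[OF \<mu>'])
  finally show ?thesis .
qed

end

lemma variation_measure_tail:
  assumes \<mu>: "complex_borel_measure \<mu>" and \<delta>: "0 < (\<delta>::ennreal)"
  obtains a where "0 \<le> a" "emeasure (variation_measure \<mu>) {s. a < \<bar>s\<bar>} < \<delta>"
proof -
  interpret finite_measure "variation_measure \<mu>" by (rule finite_variation_measure[OF \<mu>])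
  have "(\<lambda>n. emeasure (variation_measure \<mu>) {s. real n < \<bar>s\<bar>})
      \<longlonglongrightarrow> emeasure (variation_measure \<mu>) (\<Inter>n. {s. real n < \<bar>s\<bar>})"
  proof (rule Lim_emeasure_decseq)
    show "decseq (\<lambda>n. {s::real. real n < \<bar>s\<bar>})"
    proof (rule decseq_SucI, rule subsetI)
      show "s \<in> {s. real n < \<bar>s\<bar>}" if "s \<in> {s. real (Suc n) < \<bar>s\<bar>}" for n and s :: real
        using that by simp
    qed
    show "range (\<lambda>n. {s. real n < \<bar>s\<bar>}) \<subseteq> sets (variation_measure \<mu>)"
      by (auto simp: sets_variation_measure[OF \<mu>])
  qed simp
  moreover have "(\<Inter>n. {s. real n < \<bar>s\<bar>}) = {}"
  proof -
    have "\<exists>n. \<not> real n < \<bar>s\<bar>" for s :: real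
      using reals_Archimedean2[of "\<bar>s\<bar>"] by (metis less_asym)
    then show ?thesis by auto
  qed
  ultimately have "(\<lambda>n. emeasure (variation_measure \<mu>) {s. real n < \<bar>s\<bar>}) \<longlonglongrightarrow> 0" by simp
  then have "\<forall>\<^sub>F n in sequentially. emeasure (variation_measure \<mu>) {s. real n < \<bar>s\<bar>} < \<delta>"
    using \<delta> by (rule order_tendstoD(2))
  then obtain n where "emeasure (variation_measure \<mu>) {s. real n < \<bar>s\<bar>} < \<delta>"
    by (auto simp: eventually_sequentially)
  then show ?thesis by (intro that[of "real n"]) auto
qed

lemma norm_cos_transform_le:
  fixes Cos :: "real \<Rightarrow> 'a::complex_banach \<Rightarrow>\<^sub>L 'a"
  assumes cos: "cosine_function Cos" and M: "\<And>t. norm (Cos t) \<le> M" and p: "1 \<le> p"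
    and \<mu>: "\<mu> \<in> even_measures" and L: "0 \<le> L"
    and onorm: "Lp_onorm p (convolution \<mu> :: (real \<Rightarrow> 'a) \<Rightarrow> real \<Rightarrow> 'a) \<le> ennreal L"
    and x: "x \<noteq> 0"
  shows "norm (cos_transform Cos \<mu> x) \<le> (4 * M + 1) * M * L * norm x"
proof -
  have \<mu>': "complex_borel_measure \<mu>"
    using \<mu> by (auto simp: even_measures_def regular_measures_def)
  have "norm x \<le> M * norm x" using norm_cosine_le[OF cos M, of 0 x] cosine_0[OF cos M] by simp
  then have M1: "1 \<le> M" using x by simp
  define y where "y = cos_transform Cos \<mu> x"
  define B where "B = M * norm x"
  have B: "0 < B" using M1 x by (simp add: B_def)
  define \<rho> where "\<rho> = (4 * M + 1) / (2 * M + 1)"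
  have \<rho>: "1 \<le> \<rho>" "(2 * M + 1) * \<rho> = 4 * M + 1" using M1 by (simp_all add: \<rho>_def field_simps)
  \<comment> \<open>\<open>\<delta>\<close> bounds the error made by truncating the orbit of \<open>x\<close>; in the bound for \<open>y\<close> it is
    weighted by the coefficients \<open>2M\<close> and \<open>1\<close>.\<close>
  have main: "norm y \<le> (4 * M + 1) * (L * B) + (2 * M + 1) * \<delta>" if \<delta>: "0 < \<delta>" for \<delta>
  proof (cases "(2 * M + 1) * \<delta> < norm y")
    case True
    define c where "c = norm y - (2 * M + 1) * \<delta>"
    have c: "0 < c" using True by (simp add: c_def)
    obtain a where a: "0 \<le> a" "emeasure (variation_measure \<mu>) {s. a < \<bar>s\<bar>} < ennreal (\<delta> / B)"
      using variation_measure_tail[OF \<mu>', of "ennreal (\<delta> / B)"] \<delta> B by auto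
    have finite_N: "(c / (2 * M + 1)) powr p \<le> \<rho> * (1 + a * inverse (2 * N)) * (L * B) powr p"
      if N: "0 < N" for N
    proof -
      define R where "R = 2 * N + a"
      define K where "K = (2 * R) powr (1 / p) * B"
      define f where "f t = indicator {-R..R} t *\<^sub>R Cos t x" for t
      \<comment> \<open>The part of the orbit of \<open>y\<close> that surely survives in the convolution; the interval
        must contain \<open>2t\<close> for all \<open>t \<in> [-N, N]\<close>.\<close>
      define h where "h t = max 0 (norm (Cos t y) - \<delta>) * indicator {-(2*N)..2*N} t" for t
      have R: "0 < R" using N a by (simp add: R_def)
      have K: "0 < K" "K powr p = 2 * R * B powr p"
        using R B p by (simp_all add: K_def powr_mult powr_powr)
      have close: "norm (Cos t y) - \<delta> \<le> norm (convolution \<mu> f t)" if "\<bar>t\<bar> \<le> 2 * N" for t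
      proof -
        have "ennreal (norm (Cos t y - convolution \<mu> f t))
            \<le> ennreal B * emeasure (variation_measure \<mu>) {s. a < \<bar>s\<bar>}"
          using cosine_cos_transform_truncated[OF cos M \<mu>, of t a R x] that
          unfolding y_def f_def B_def R_def by simp
        also have "\<dots> \<le> ennreal B * ennreal (\<delta> / B)"
          using a(2) by (intro mult_left_mono) auto
        also have "\<dots> = ennreal \<delta>"
          using B \<delta> by (simp add: ennreal_mult[symmetric])
        finally have "norm (Cos t y - convolution \<mu> f t) \<le> \<delta>" using \<delta> by simp
        then show ?thesis using norm_triangle_ineq2[of "Cos t y" "convolution \<mu> f t"] by linarith
      qed
      have "(\<lambda>t. norm (Cos t y)) \<in> borel_measurable borel"
        by (intro borel_measurable_continuous_onI continuous_on_norm continuous_on_cosine[OF cos M] continuous_on_id)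
      then have h_meas: "h \<in> borel_measurable borel"
        unfolding h_def by measurable
      have h0: "0 \<le> h t" for t by (simp add: h_def)
      have f1: "approximable f"
        unfolding f_def
        by (intro approximable_indicator approximable_cosine[OF cos M] continuous_on_id) auto
      have f2: "approximable (\<lambda>s. f (t - s))" for t
      proof -
        have "indicat_real {-R..R} (t - s) = indicator {t - R..t + R} s" for s
          by (auto simp: indicator_def)
        then show ?thesis
          unfolding f_def
          by (auto intro!: approximable_indicator approximable_cosine[OF cos M] continuous_intros)
      qed
      have fK: "(\<integral>\<^sup>+t. ennreal (norm (f t) powr p) \<partial>lborel) \<le> ennreal (K powr p)"
      proof -
        have "norm (f t) powr p \<le> B powr p" for t
          using norm_cosine_le[OF cos M, of t x] B p
          by (auto simp: f_def B_def indicator_def intro!: powr_mono2)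
        moreover have "f t = 0" if "t \<notin> {-R..R}" for t
          using that by (simp add: f_def)
        ultimately have "ennreal (norm (f t) powr p) \<le> ennreal (B powr p) * indicator {-R..R} t" for t
          by (cases "t \<in> {-R..R}") (simp_all add: ennreal_leI)
        then have "(\<integral>\<^sup>+t. ennreal (norm (f t) powr p) \<partial>lborel)
            \<le> (\<integral>\<^sup>+t. ennreal (B powr p) * indicator {-R..R} t \<partial>lborel)"
          by (intro nn_integral_mono)
        also have "\<dots> = ennreal (K powr p)"
          using R B by (subst nn_integral_cmult_indicator) (auto simp: K(2) ennreal_mult[symmetric] mult.commute)
        finally show ?thesis .
      qed
      have "(\<integral>\<^sup>+t. ennreal (h t powr p) \<partial>lborel) \<le> ennreal ((L * K) powr p)"
        using close by (intro Lp_onorm_convolution_lower_bound[OF \<mu>' p L K(1) onorm f1 f2 fK h_meas h0])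
          (auto simp: h_def indicator_def abs_le_iff)
      moreover have "c \<le> 2 * M * h t + h (2 * t)" if "\<bar>t\<bar> \<le> N" for t
      proof -
        have "\<bar>2 * t\<bar> \<le> 2 * N" "\<bar>t\<bar> \<le> 2 * N" using that by simp_all
        then have "norm (Cos t y) - \<delta> \<le> h t" "norm (Cos (2 * t) y) - \<delta> \<le> h (2 * t)"
          by (auto simp: h_def indicator_def abs_le_iff)
        moreover from this(1) have "2 * M * (norm (Cos t y) - \<delta>) \<le> 2 * M * h t"
          using M1 by (intro mult_left_mono) auto
        ultimately show ?thesis
          using norm_le_cosine_double[OF cos M, of y t] by (simp add: c_def algebra_simps)
      qed
      ultimately have "2 * N * (c / (2 * M + 1)) powr p \<le> (4 * M + 1) / (2 * (2 * M + 1)) * (L * K) powr p"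
        using p M1 N c by (intro two_scale_average[OF _ _ _ _ _ h_meas h0]) auto
      also have "(L * K) powr p = 2 * (2 * N + a) * (L * B) powr p"
        using L B K by (simp add: powr_mult R_def)
      also have "(4 * M + 1) / (2 * (2 * M + 1)) = \<rho> / 2" by (simp add: \<rho>_def)
      also have "\<rho> / 2 * (2 * (2 * N + a) * (L * B) powr p)
          = 2 * N * (\<rho> * (1 + a * inverse (2 * N)) * (L * B) powr p)"
        using N by (simp add: field_simps)
      finally show ?thesis using N by simp
    qed
    \<comment> \<open>Let \<open>N\<close> tend to infinity with \<open>a\<close> fixed.\<close>
    have "(c / (2 * M + 1)) powr p \<le> \<rho> * (1 + a * 0) * (L * B) powr p"
    proof (rule tendsto_lowerbound)
      show "((\<lambda>N. \<rho> * (1 + a * inverse (2 * N)) * (L * B) powr p)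
          \<longlongrightarrow> \<rho> * (1 + a * 0) * (L * B) powr p) at_top"
        by (intro tendsto_intros tendsto_inverse_0_at_top filterlim_tendsto_pos_mult_at_top[OF tendsto_const]
            filterlim_ident) simp
      show "\<forall>\<^sub>F N in at_top. (c / (2 * M + 1)) powr p \<le> \<rho> * (1 + a * inverse (2 * N)) * (L * B) powr p"
        using eventually_gt_at_top[of 0] by eventually_elim (rule finite_N)
    qed simp
    \<comment> \<open>As \<open>\<rho> \<ge> 1\<close>, enlarging \<open>\<rho>\<close> to \<open>\<rho>\<^sup>p\<close> allows the \<open>p\<close>-th root to be taken.\<close>
    also have "\<dots> = \<rho> powr 1 * (L * B) powr p" using \<rho> by simp
    also have "\<dots> \<le> \<rho> powr p * (L * B) powr p"
      using \<rho> p by (intro mult_right_mono powr_mono) auto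
    also have "\<dots> = (\<rho> * (L * B)) powr p" using \<rho> L B by (simp add: powr_mult)
    finally have powr_le: "(c / (2 * M + 1)) powr p \<le> (\<rho> * (L * B)) powr p" .
    have "0 \<le> \<rho> * (L * B)" using \<rho>(1) L B by simp
    then have "c / (2 * M + 1) \<le> \<rho> * (L * B)"
      using powr_le p powr_less_mono2[of p "\<rho> * (L * B)" "c / (2 * M + 1)"] by linarith
    then have "c \<le> (2 * M + 1) * \<rho> * (L * B)"
      using M1 by (simp add: field_simps)
    then show ?thesis by (simp add: c_def \<rho>)
  next
    case False
    then show ?thesis using M1 L B by (intro order_trans[OF _ le_add_same_cancel2[THEN iffD2]]) auto
  qed
  have "norm y \<le> (4 * M + 1) * (L * B)"
  proof (rule field_le_epsilon)
    fix e :: real assume "0 < e"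
    then show "norm y \<le> (4 * M + 1) * (L * B) + e"
      using main[of "e / (2 * M + 1)"] M1 by simp
  qed
  then show ?thesis by (simp add: y_def B_def algebra_simps)
qed

theorem theorem3p1:
  fixes Cos :: "real \<Rightarrow> 'a::complex_banach \<Rightarrow>\<^sub>L 'a" and p M :: real
  assumes "cosine_function Cos"
    and "bounded (range Cos)"
    and "M = (SUP s. norm (Cos s))"
    and "1 \<le> p"
  shows "\<forall>\<mu>\<in>even_measures.
    ennreal (onorm (cos_transform Cos \<mu>))
      \<le> ennreal (5 * M\<^sup>2) *
          Lp_onorm p (convolution \<mu> :: (real \<Rightarrow> 'a) \<Rightarrow> (real \<Rightarrow> 'a))"
proof
  fix \<mu> :: "real set \<Rightarrow> complex" assume \<mu>: "\<mu> \<in> even_measures"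
  let ?T = "cos_transform Cos \<mu>"
  let ?L = "Lp_onorm p (convolution \<mu> :: (real \<Rightarrow> 'a) \<Rightarrow> (real \<Rightarrow> 'a))"
  have M: "norm (Cos t) \<le> M" for t
  proof -
    have "bdd_above (range (\<lambda>s. norm (Cos s)))"
      using assms(2) unfolding bounded_iff by (auto intro: bdd_aboveI2)
    then show ?thesis unfolding assms(3) by (intro cSUP_upper) auto
  qed
  have T0: "?T 0 = 0"
  proof -
    have "approximable (\<lambda>_. 0 :: 'a)" by (rule approximable_continuous[of _ 0]) auto
    then have "ennreal (norm (integral_wrt \<mu> (\<lambda>_. 0 :: 'a))) \<le> 0"
      using norm_integral_wrt_le[of \<mu> "\<lambda>_. 0 :: 'a"] \<mu> by (simp add: even_measures_def regular_measures_def)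
    then show ?thesis by (simp add: cos_transform_def)
  qed
  show "ennreal (onorm ?T) \<le> ennreal (5 * M\<^sup>2) * ?L"
  proof (cases "\<exists>x::'a. x \<noteq> 0")
    case True
    then obtain x0 :: 'a where x0: "x0 \<noteq> 0" by blast
    have "norm x0 \<le> M * norm x0"
      using norm_cosine_le[OF assms(1) M, of 0 x0] cosine_0[OF assms(1) M] by simp
    then have M1: "1 \<le> M" using x0 by simp
    show ?thesis
    proof (cases "?L = top")
      case True
      then show ?thesis using M1 by (simp add: ennreal_mult_top)
    next
      case False
      then obtain L where L: "0 \<le> L" "?L = ennreal L" by (cases ?L) auto
      have "(4 * M + 1) * M \<le> 5 * M\<^sup>2"
        using M1 by (simp add: power2_eq_square algebra_simps)
      then have "(4 * M + 1) * M * (L * norm x) \<le> 5 * M\<^sup>2 * (L * norm x)" for x :: 'a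
        using L by (intro mult_right_mono) auto
      then have "norm (?T x) \<le> 5 * M\<^sup>2 * L * norm x" for x
        using norm_cos_transform_le[OF assms(1) M assms(4) \<mu> L(1), of x] L(2) T0
        by (cases "x = 0") (auto simp: mult.assoc intro: order_trans)
      then have "onorm ?T \<le> 5 * M\<^sup>2 * L"
        using L by (intro onorm_bound) auto
      then show ?thesis
        using L by (simp add: ennreal_mult[symmetric] ennreal_leI)
    qed
  next
    case False
    then have "norm (?T x) \<le> 0 * norm x" for x by simp
    then have "onorm ?T \<le> 0" by (intro onorm_bound) auto
    then show ?thesis by (simp add: ennreal_neg)
  qed
qed

end
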